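(* Let $n\geq 5$ and let $G$ be a connected graph on $n$ vertices with no pendant vertex. Then $F(G)\geq F(C_n)$ if $n\leq 16$, and $F(G)\geq F(C_{3,3}^n)$ if $n>16$. Moreover, $$F(G)\geq \min\left\{n^2+1,\ \frac{n^2+17n}{2}\right\}.$$
   Context: All graphs are finite, simple and undirected. A pendant vertex is a vertex of degree one. $C_m$ is the cycle on $m$ vertices. For $n\geq 5$, $C_{3,3}^n$ is the graph on $n$ vertices obtained as follows: if $n\geq 6$, take a path on $n-4$ vertices and identify one end vertex of the path with a vertex of a triangle $C_3$ and the other end vertex with a vertex of a second (disjoint) triangle $C_3$; if $n=5$, it is two triangles sharing exactly one vertex. A connected subgraph of a graph $G=(V,E)$ is a graph $(V',E')$ with $\emptyset\neq V'\subseteq V$, $E'\subseteq E$, every edge of $E'$ having both endpoints in $V'$, and $(V',E')$ connected; distinct pairs $(V',E')$ are counted separately. The core index $F(G)$ is the number of connected subgraphs of $G$. *)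

theory Defs
  imports Complex_Main
begin

text \<open>A graph is a pair (V, E) of vertices and edges, an edge being a two-element set of vertices.\<close>

type_synonym 'a ugraph = "'a set \<times> 'a set set"

definition simple_graph :: "'a ugraph \<Rightarrow> bool" where
  "simple_graph G \<longleftrightarrow> finite (fst G) \<and> (\<forall>e\<in>snd G. e \<subseteq> fst G \<and> card e = 2)"

definition degree :: "'a ugraph \<Rightarrow> 'a \<Rightarrow> nat" where
  "degree G v = card {e \<in> snd G. v \<in> e}"

definition pendant_vertex :: "'a ugraph \<Rightarrow> 'a \<Rightarrow> bool" where
  "pendant_vertex G v \<longleftrightarrow> v \<in> fst G \<and> degree G v = 1"

definition adj :: "'a ugraph \<Rightarrow> ('a \<times> 'a) set" where
  "adj G = {(x, y). {x, y} \<in> snd G}"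

definition connected_graph :: "'a ugraph \<Rightarrow> bool" where
  "connected_graph G \<longleftrightarrow> fst G \<noteq> {} \<and> (\<forall>u\<in>fst G. \<forall>v\<in>fst G. (u, v) \<in> (adj G)\<^sup>*)"

definition subgraph :: "'a ugraph \<Rightarrow> 'a ugraph \<Rightarrow> bool" where
  "subgraph H G \<longleftrightarrow> fst H \<subseteq> fst G \<and> snd H \<subseteq> snd G \<and> (\<forall>e\<in>snd H. e \<subseteq> fst H)"

definition core_index :: "'a ugraph \<Rightarrow> nat" where
  "core_index G = card {H. subgraph H G \<and> connected_graph H}"

text \<open>This is the cycle on n vertices only for n at least 3.\<close>

definition cycle_graph :: "nat \<Rightarrow> nat ugraph" where
  "cycle_graph n = ({..<n}, {{i, (i + 1) mod n} |i. i < n})"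

text \<open>For n at least 5. The path has the n - 4 vertices 0, ..., n - 5; its ends 0 and n - 5 lie on
  the triangles \<open>{0, n - 4, n - 3}\<close> and \<open>{n - 5, n - 2, n - 1}\<close>. For n = 5 the two ends coincide,
  and the triangles share exactly the vertex 0.\<close>

definition two_triangle_graph :: "nat \<Rightarrow> nat ugraph" where
  "two_triangle_graph n =
    ({..<n},
     {{i, i + 1} |i. i + 1 < n - 4}
     \<union> {{0, n - 4}, {0, n - 3}, {n - 4, n - 3}}
     \<union> {{n - 5, n - 2}, {n - 5, n - 1}, {n - 2, n - 1}})"

end

theory Submission
  imports Defs
begin

text \<open>
  Write n and m for the numbers of vertices and edges; minimum degree two forces m at least n.
  Contracting an edge va that lies in no triangle lowers the core index by at least the number of
  connected subgraphs that avoid the edge va and contain v or a.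
  If m = n the graph is a cycle, this number is 2n - 1, and contraction down to a triangle yields
  n^2 + 1. If m > n, one shows (n^2 + 17n)/2 by induction, now also allowing pendant vertices:
  for a bridge va both sides are non-trees by the handshake lemma, and a connected non-tree on k
  vertices has at least k + 4 connected subgraphs through a given vertex (k non-spanning and 4 spanning
  ones), so the loss is at least n + 8, which is the increment of the bound; a non-bridge does at least
  as well, a pendant vertex can be deleted, and if every edge lies in a triangle then m is so large that an
  edge can be deleted. The house (a pentagon with a chord) violates the bound by one at n = 5, so
  the step from 5 to 6 vertices has to gain one more.
\<close>

section \<open>Connectedness and cuts\<close>

text \<open>Both lower bounds are matched by equal upper bounds for the two named graphs, so
  comparing core indices reduces to comparing n^2 + 1 with (n^2 + 17n)/2. These change order between
  16 and 17, where the larger root of n^2 - 17n + 2 lies. From n - 1 to n they grow by 2n - 1 and n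
  + 8. A triangle on the contracted edge would create parallel edges and so change m - n, which must
  stay fixed. Deleting an edge of a triangle can create a pendant vertex; this is why the induction
  for m > n has to admit such vertices. At six vertices the bound has no slack: two triangles joined
  by an edge attain 69, while the induction hypothesis guarantees only 54 on five vertices, not 55.
  So a contraction at six vertices must lose 15, and a bridge there is counted directly instead of
  being contracted.\<close>

lemma rtrancl_crosses:
  assumes "(x, y) \<in> r\<^sup>*" "x \<in> S" "y \<notin> S"
  shows "\<exists>u v. (u, v) \<in> r \<and> u \<in> S \<and> v \<notin> S"
  using assms by (induction rule: rtrancl_induct) auto

text \<open>\<open>connected_graph\<close> alone lets a walk use vertices outside \<open>V\<close>;
  the inclusion assumed for \<open>E\<close> keeps both ends of the crossing edge inside.\<close>

lemma connected_cut:
  assumes "connected_graph (V, E)" "E \<subseteq> Pow V" "x \<in> V" "y \<in> V" "x \<in> S" "y \<notin> S"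
  obtains u v where "{u, v} \<in> E" "u \<in> V" "v \<in> V" "u \<in> S" "v \<notin> S"
proof -
  have "(x, y) \<in> (adj (V, E))\<^sup>*" using assms by (auto simp: connected_graph_def)
  from rtrancl_crosses[OF this assms(5,6)] show ?thesis
    using that assms(2) by (auto simp: adj_def)
qed

text \<open>Apply the cut condition to the set of vertices reached from \<open>u\<close>: no edge
  leaves it. Together with \<open>connected_cut\<close> this lets most connectivity arguments work
  with cuts instead of paths.\<close>

lemma connected_graphI:
  assumes "V \<noteq> {}"
    and "\<And>S. S \<subseteq> V \<Longrightarrow> S \<noteq> {} \<Longrightarrow> S \<noteq> V \<Longrightarrow> \<exists>u\<in>S. \<exists>v\<in>V - S. {u, v} \<in> E"
  shows "connected_graph (V, E)"
  unfolding connected_graph_def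
proof (intro conjI ballI)
  show "fst (V, E) \<noteq> {}" using assms by simp
next
  fix u v assume uv: "u \<in> fst (V, E)" "v \<in> fst (V, E)"
  show "(u, v) \<in> (adj (V, E))\<^sup>*"
  proof (rule ccontr)
    assume n: "(u, v) \<notin> (adj (V, E))\<^sup>*"
    define S where "S = {w \<in> V. (u, w) \<in> (adj (V, E))\<^sup>*}"
    have "S \<subseteq> V" "S \<noteq> {}" "S \<noteq> V" using uv n by (auto simp: S_def)
    then obtain p q where "p \<in> S" "q \<in> V - S" "{p, q} \<in> E" using assms(2) by meson
    then have "(u, q) \<in> (adj (V, E))\<^sup>*"
      by (auto simp: S_def adj_def intro: rtrancl_into_rtrancl)
    with \<open>q \<in> V - S\<close> show False by (auto simp: S_def)
  qed
qed

lemma connected_graph_nonempty: "connected_graph (V, E) \<Longrightarrow> V \<noteq> {}"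
  by (simp add: connected_graph_def)

lemma connected_graph_singleton: "connected_graph ({v}, D)"
  by (auto simp: connected_graph_def)

lemma connected_graph_mono:
  assumes "connected_graph (V, D)" "D \<subseteq> E"
  shows "connected_graph (V, E)"
proof -
  have "adj (V, D) \<subseteq> adj (V, E)" using assms by (auto simp: adj_def)
  from rtrancl_mono[OF this] show ?thesis using assms(1) by (auto simp: connected_graph_def)
qed

lemma connected_graph_insert:
  assumes "connected_graph (W, D)" "D \<subseteq> Pow W" "u \<in> W"
  shows "connected_graph (insert v W, insert {u, v} D)"
proof (rule connected_graphI)
  fix S assume S: "S \<subseteq> insert v W" "S \<noteq> {}" "S \<noteq> insert v W"
  show "\<exists>p\<in>S. \<exists>q\<in>insert v W - S. {p, q} \<in> insert {u, v} D"
  proof (cases "u \<in> S \<longleftrightarrow> v \<in> S")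
    case False
    then show ?thesis using assms(3) S(1) by (auto simp: insert_commute)
  next
    case True
    then obtain x y where xy: "x \<in> W" "x \<in> S" "y \<in> W" "y \<notin> S"
      using S assms(3) by blast
    show ?thesis
      by (rule connected_cut[OF assms(1,2) xy(1,3,2,4)]) auto
  qed
qed simp

lemma simple_graph_iff:
  "simple_graph (V, E) \<longleftrightarrow> finite V \<and> E \<subseteq> Pow V \<and> (\<forall>e\<in>E. card e = 2)"
  by (auto simp: simple_graph_def)

lemma simple_graph_edgeE:
  assumes "simple_graph (V, E)" "e \<in> E"
  obtains x y where "e = {x, y}" "x \<noteq> y" "x \<in> V" "y \<in> V"
proof -
  have "card e = 2" "e \<subseteq> V" using assms by (auto simp: simple_graph_iff)
  then show ?thesis using that by (auto simp: card_2_iff)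
qed

lemma simple_graph_finite_edges: "simple_graph (V, E) \<Longrightarrow> finite E"
  by (auto simp: simple_graph_iff intro: finite_subset)

lemma simple_graph_mono: "simple_graph (V, E) \<Longrightarrow> D \<subseteq> E \<Longrightarrow> simple_graph (V, D)"
  by (auto simp: simple_graph_iff)

lemma simple_graph_induced: "simple_graph (V, E) \<Longrightarrow> W \<subseteq> V \<Longrightarrow> simple_graph (W, {e \<in> E. e \<subseteq> W})"
  by (auto simp: simple_graph_iff intro: finite_subset)

lemma simple_graph_noteq: "simple_graph (V, E) \<Longrightarrow> {x, y} \<in> E \<Longrightarrow> x \<noteq> y \<and> x \<in> V \<and> y \<in> V"
  by (auto simp: simple_graph_iff)

lemma handshake:
  assumes "simple_graph (V, E)"
  shows "(\<Sum>v\<in>V. degree (V, E) v) = 2 * card E"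
proof -
  have "card {v \<in> V. v \<in> e} = 2" if "e \<in> E" for e
  proof -
    have "{v \<in> V. v \<in> e} = e" using that assms by (auto simp: simple_graph_iff)
    then show ?thesis using that assms by (auto simp: simple_graph_iff)
  qed
  then show ?thesis unfolding degree_def snd_conv
    by (intro sum_multicount) (use assms simple_graph_finite_edges simple_graph_iff in blast)+
qed

text \<open>The component of \<open>a\<close>. Only the edge set is an argument, so deleting an
  edge, or all edges at a vertex, is just a change of \<open>E\<close>.\<close>

definition reach :: "'a set set \<Rightarrow> 'a \<Rightarrow> 'a set" where
  "reach E a = {u. (a, u) \<in> {(x, y). {x, y} \<in> E}\<^sup>*}"

lemma reach_self: "a \<in> reach E a"
  by (simp add: reach_def)

lemma reach_closed: "u \<in> reach E a \<Longrightarrow> {u, w} \<in> E \<Longrightarrow> w \<in> reach E a"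
  by (auto simp: reach_def intro: rtrancl_into_rtrancl)

lemma reach_subset: 
  assumes "E \<subseteq> Pow V" "a \<in> V"
  shows "reach E a \<subseteq> V"
proof
  fix u assume "u \<in> reach E a"
  then have "(a, u) \<in> {(x, y). {x, y} \<in> E}\<^sup>*" by (simp add: reach_def)
  then show "u \<in> V" using assms by (induction rule: rtrancl_induct) auto
qed

lemma connected_reach: "connected_graph (reach E a, {e \<in> E. e \<subseteq> reach E a})"
proof (rule connected_graphI)
  show "reach E a \<noteq> {}" using reach_self[of a E] by blast
next
  fix S assume S: "S \<subseteq> reach E a" "S \<noteq> {}" "S \<noteq> reach E a"
  \<comment> \<open>Reachability from \<open>a\<close> yields a crossing edge only for sets that
    contain \<open>a\<close>; the other sets are treated through their complement.\<close>
  have *: "\<exists>u v. u \<in> T \<and> v \<in> reach E a - T \<and> {u, v} \<in> E"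
    if T: "a \<in> T" "T \<subseteq> reach E a" "T \<noteq> reach E a" for T
  proof -
    obtain w where w: "w \<in> reach E a" "w \<notin> T" using T by blast
    then have "(a, w) \<in> {(x, y). {x, y} \<in> E}\<^sup>*" by (simp add: reach_def)
    from rtrancl_crosses[OF this T(1) w(2)] show ?thesis using T reach_closed[of _ E a] by blast
  qed
  show "\<exists>u\<in>S. \<exists>v\<in>reach E a - S. {u, v} \<in> {e \<in> E. e \<subseteq> reach E a}"
  proof (cases "a \<in> S")
    case True
    then show ?thesis using *[of S] S by auto
  next
    case False
    then have "\<exists>u v. u \<in> reach E a - S \<and> v \<in> reach E a - (reach E a - S) \<and> {u, v} \<in> E"
      using S reach_self[of a E] by (intro *) auto
    then obtain u v where uv: "u \<in> reach E a - S" "v \<in> S" "{v, u} \<in> E"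
      by (auto simp: insert_commute)
    then show ?thesis using S by auto
  qed
qed

section \<open>Growing connected subgraphs\<close>

lemma connected_subgraph_step:
  assumes G: "connected_graph (V, E)" "simple_graph (V, E)"
    and H: "subgraph H (V, E)" "connected_graph H" "fst H \<noteq> V"
  obtains H' where "subgraph H' (V, E)" "connected_graph H'" "fst H \<subseteq> fst H'" "snd H \<subseteq> snd H'"
    "card (fst H') = Suc (card (fst H))" "card (snd H') = Suc (card (snd H))"
proof -
  obtain W D where WD: "H = (W, D)" by (cases H)
  have W: "W \<subseteq> V" "D \<subseteq> E" "D \<subseteq> Pow W" "W \<noteq> V" using H by (auto simp: WD subgraph_def)
  have "W \<noteq> {}" using H connected_graph_nonempty WD by blast
  then obtain x y where xy: "x \<in> W" "y \<in> V" "y \<notin> W" using W by blast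
  have EV: "E \<subseteq> Pow V" using G by (simp add: simple_graph_iff)
  obtain u v where uv: "{u, v} \<in> E" "u \<in> V" "v \<in> V" "u \<in> W" "v \<notin> W"
    by (rule connected_cut[OF G(1) EV _ xy(2) xy(1,3)]) (use W xy in auto)
  have fin: "finite W" "finite D"
    using W G simple_graph_finite_edges[OF G(2)] by (auto simp: simple_graph_iff intro: finite_subset)
  show ?thesis
  proof (rule that[of "(insert v W, insert {u, v} D)"])
    show "connected_graph (insert v W, insert {u, v} D)"
      by (rule connected_graph_insert) (use H W uv WD in auto)
    show "card (snd (insert v W, insert {u, v} D)) = Suc (card (snd H))"
    proof -
      have "{u, v} \<notin> D" using W uv by auto
      then show ?thesis using fin by (simp add: WD)
    qed
  qed (use W uv fin in \<open>auto simp: WD subgraph_def\<close>)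
qed

text \<open>Every added vertex brings exactly one added edge. The edge count, written without
  subtraction, makes a single vertex grow into a tree, which is spanning for
  \<open>k = card V\<close>.\<close>

lemma connected_subgraph_extend:
  assumes G: "connected_graph (V, E)" "simple_graph (V, E)"
    and H: "subgraph H (V, E)" "connected_graph H"
    and k: "card (fst H) \<le> k" "k \<le> card V"
  shows "\<exists>H'. subgraph H' (V, E) \<and> connected_graph H' \<and> fst H \<subseteq> fst H' \<and> card (fst H') = k
    \<and> card (snd H') + card (fst H) = card (snd H) + k"
  using k
proof (induction rule: dec_induct)
  case base
  then show ?case using H by (intro exI[of _ H]) auto
next
  case (step i)
  then obtain K where K: "subgraph K (V, E)" "connected_graph K" "fst H \<subseteq> fst K"
    "card (fst K) = i" "card (snd K) + card (fst H) = card (snd H) + i" by auto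
  then have "fst K \<noteq> V" using step by auto
  with connected_subgraph_step[OF G K(1,2)] show ?case
    by (metis K(3-5) add_Suc add_Suc_right order_trans)
qed

lemma subgraph_singleton: "v \<in> V \<Longrightarrow> subgraph ({v}, {}) (V, E)"
  by (simp add: subgraph_def)

lemma spanning_tree_exists:
  assumes G: "connected_graph (V, E)" "simple_graph (V, E)"
  obtains T where "T \<subseteq> E" "connected_graph (V, T)" "card T + 1 = card V"
proof -
  obtain v where v: "v \<in> V" using G connected_graph_nonempty by blast
  have fV: "finite V" using G by (simp add: simple_graph_iff)
  then have "1 \<le> card V" using v by (metis One_nat_def Suc_leI card_gt_0_iff empty_iff)
  then obtain H where H: "subgraph H (V, E)" "connected_graph H" "card (fst H) = card V"
     "card (snd H) + 1 = card V"
    using connected_subgraph_extend[OF G subgraph_singleton[OF v] connected_graph_singleton, of "card V"]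
    by auto
  have "fst H = V" using H(1,3) fV by (simp add: subgraph_def card_subset_eq)
  then show ?thesis using that[of "snd H"] H by (metis prod.collapse subgraph_def snd_conv)
qed

section \<open>Families of connected subgraphs\<close>

definition conn_subgraphs :: "'a ugraph \<Rightarrow> 'a ugraph set" where
  "conn_subgraphs G = {H. subgraph H G \<and> connected_graph H}"

definition rooted :: "'a ugraph \<Rightarrow> 'a \<Rightarrow> 'a ugraph set" where
  "rooted G v = {H \<in> conn_subgraphs G. v \<in> fst H}"

definition nonspanning :: "'a ugraph \<Rightarrow> 'a \<Rightarrow> 'a ugraph set" where
  "nonspanning G v = {H \<in> rooted G v. fst H \<noteq> fst G}"

text \<open>Edge sets suffice because the vertex set is fixed. These subgraphs contain every root,
  so they contribute the same number to \<open>card_rooted\<close> for all \<open>v\<close>.\<close>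

definition spanning :: "'a ugraph \<Rightarrow> 'a set set set" where
  "spanning G = {D. D \<subseteq> snd G \<and> connected_graph (fst G, D)}"

lemma core_index_eq: "core_index G = card (conn_subgraphs G)"
  by (simp add: core_index_def conn_subgraphs_def)

lemma finite_conn_subgraphs:
  assumes "simple_graph (V, E)"
  shows "finite (conn_subgraphs (V, E))"
proof (rule finite_subset)
  show "conn_subgraphs (V, E) \<subseteq> Pow V \<times> Pow E"
    by (auto simp: conn_subgraphs_def subgraph_def)
  show "finite (Pow V \<times> Pow E)"
    using assms simple_graph_finite_edges by (auto simp: simple_graph_iff)
qed

lemma finite_rooted: "simple_graph (V, E) \<Longrightarrow> finite (rooted (V, E) v)"
  using finite_conn_subgraphs[of V E] by (simp add: rooted_def)

lemma conn_subgraphs_mono: "W \<subseteq> V \<Longrightarrow> D \<subseteq> E \<Longrightarrow> conn_subgraphs (W, D) \<subseteq> conn_subgraphs (V, E)"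
  by (auto simp: conn_subgraphs_def subgraph_def)

lemma core_index_mono:
  assumes "simple_graph (V, E)" "D \<subseteq> E"
  shows "core_index (V, D) \<le> core_index (V, E)"
  unfolding core_index_eq using assms by (intro card_mono finite_conn_subgraphs conn_subgraphs_mono) auto

text \<open>Growing from \<open>v\<close> one vertex at a time gives one nonspanning subgraph of
  each order from 1 to \<open>card V - 1\<close>. Two edges at \<open>v\<close> give a second one of
  order 2.\<close>

lemma nonspanning_ge:
  assumes G: "connected_graph (V, E)" "simple_graph (V, E)" "v \<in> V"
  shows "card (nonspanning (V, E) v) \<ge> card V - 1"
    and "{v, x} \<in> E \<Longrightarrow> {v, y} \<in> E \<Longrightarrow> x \<noteq> y \<Longrightarrow> card (nonspanning (V, E) v) \<ge> card V"
proof -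
  have fV: "finite V" using G by (simp add: simple_graph_iff)
  have fin: "finite (nonspanning (V, E) v)" using finite_rooted[OF G(2)] by (simp add: nonspanning_def)
  have "\<exists>K. \<forall>k\<in>{1..<card V}. K k \<in> nonspanning (V, E) v \<and> card (fst (K k)) = k"
  proof (rule bchoice, rule ballI)
    fix k assume "k \<in> {1..<card V}"
    then show "\<exists>H. H \<in> nonspanning (V, E) v \<and> card (fst H) = k"
      using connected_subgraph_extend[OF G(1,2) subgraph_singleton[OF G(3)] connected_graph_singleton, of k]
      by (auto simp: nonspanning_def rooted_def conn_subgraphs_def)
  qed
  then obtain K where K: "\<And>k. k \<in> {1..<card V} \<Longrightarrow> K k \<in> nonspanning (V, E) v \<and> card (fst (K k)) = k"
    by meson
  have inj: "inj_on K {1..<card V}" by (rule inj_on_inverseI[of _ "\<lambda>H. card (fst H)"]) (use K in blast)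
  have sub: "K ` {1..<card V} \<subseteq> nonspanning (V, E) v" using K by blast
  have cK: "card (K ` {1..<card V}) = card V - 1" using card_image[OF inj] by simp
  show "card (nonspanning (V, E) v) \<ge> card V - 1"
    using card_mono[OF fin sub] cK by simp
  assume xy: "{v, x} \<in> E" "{v, y} \<in> E" "x \<noteq> y"
  have d: "v \<noteq> x" "v \<noteq> y" "x \<in> V" "y \<in> V" using xy G(2) by (auto dest: simple_graph_noteq)
  have c3: "card V \<ge> 3"
    using card_mono[OF fV, of "{v, x, y}"] d xy G(3) by simp
  have sp: "({v, w}, {{v, w}}) \<in> nonspanning (V, E) v" if "w \<in> {x, y}" for w
  proof -
    have "connected_graph ({v, w}, {{v, w}})"
      using connected_graph_insert[OF connected_graph_singleton, of "{}" v v w]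
      by (simp add: insert_commute)
    moreover have "{v, w} \<noteq> V" using c3 card_insert_le_m1[of 2 "{w}" v] by auto
    ultimately show ?thesis using that xy d G(3)
      by (auto simp: nonspanning_def rooted_def conn_subgraphs_def subgraph_def)
  qed
  \<comment> \<open>The chosen \<open>K 2\<close> equals at most one of the edges from
    \<open>v\<close> to \<open>x\<close> and to \<open>y\<close>; \<open>w\<close> is the end of one
    that it misses.\<close>
  obtain w where w: "w \<in> {x, y}" "K 2 \<noteq> ({v, w}, {{v, w}})"
    using xy(3) d by (metis doubleton_eq_iff insertCI prod.inject)
  have "({v, w}, {{v, w}}) \<notin> K ` {1..<card V}"
  proof
    assume "({v, w}, {{v, w}}) \<in> K ` {1..<card V}"
    then obtain k where k: "k \<in> {1..<card V}" "({v, w}, {{v, w}}) = K k" by blast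
    then have "k = card {v, w}" using K by (metis fst_conv)
    also have "\<dots> = 2" using w d by auto
    finally show False using w k by simp
  qed
  then have "card (insert ({v, w}, {{v, w}}) (K ` {1..<card V})) = card V"
    using cK c3 by simp
  moreover have "insert ({v, w}, {{v, w}}) (K ` {1..<card V}) \<subseteq> nonspanning (V, E) v"
    using sp w sub by blast
  ultimately show "card (nonspanning (V, E) v) \<ge> card V" using card_mono[OF fin] by metis
qed

lemma card_rooted:
  assumes "simple_graph (V, E)" "v \<in> V"
  shows "card (rooted (V, E) v) = card (nonspanning (V, E) v) + card (spanning (V, E))"
proof -
  have EV: "E \<subseteq> Pow V" using assms by (simp add: simple_graph_iff)
  have "rooted (V, E) v = nonspanning (V, E) v \<union> Pair V ` spanning (V, E)"
  proof (intro set_eqI iffI)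
    fix H assume "H \<in> rooted (V, E) v"
    then show "H \<in> nonspanning (V, E) v \<union> Pair V ` spanning (V, E)"
      by (cases H) (auto simp: nonspanning_def rooted_def conn_subgraphs_def spanning_def subgraph_def)
  next
    fix H assume "H \<in> nonspanning (V, E) v \<union> Pair V ` spanning (V, E)"
    then show "H \<in> rooted (V, E) v"
    proof
      assume "H \<in> Pair V ` spanning (V, E)"
      then obtain D where "H = (V, D)" "D \<subseteq> E" "connected_graph (V, D)" by (auto simp: spanning_def)
      then show ?thesis using assms(2) EV by (auto simp: rooted_def conn_subgraphs_def subgraph_def)
    qed (simp add: nonspanning_def)
  qed
  moreover have "nonspanning (V, E) v \<inter> Pair V ` spanning (V, E) = {}"
    by (auto simp: nonspanning_def)
  moreover have "finite (rooted (V, E) v)" using finite_rooted[OF assms(1)] .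
  moreover have "card (Pair V ` spanning (V, E)) = card (spanning (V, E))"
    by (rule card_image) (auto simp: inj_on_def)
  ultimately show ?thesis by (metis card_Un_disjoint finite_Un)
qed

section \<open>Edge exchange and connected spanning subgraphs\<close>

text \<open>A path in \<open>D\<close> from \<open>y\<close> to \<open>x\<close> enters
  \<open>x\<close> by some edge \<open>{x, z}\<close>, which lies on a cycle with the new edge
  \<open>{x, y}\<close> and so may be dropped. \<open>C\<close> is the component of \<open>y\<close>
  once \<open>x\<close> is removed, and \<open>z\<close> is a vertex of \<open>C\<close> adjacent to
  \<open>x\<close>.\<close>

lemma edge_exchange:
  assumes G: "connected_graph (V, D)" "D \<subseteq> Pow V" and xy: "x \<in> V" "y \<in> V" "x \<noteq> y" "{x, y} \<notin> D"
  obtains z where "{x, z} \<in> D" "z \<noteq> y" "connected_graph (V, insert {x, y} D - {{x, z}})"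
proof -
  define C where "C = reach {d \<in> D. x \<notin> d} y"
  have C: "y \<in> C" "C \<subseteq> V - {x}"
    unfolding C_def using reach_self[of y] reach_subset[of "{d \<in> D. x \<notin> d}" "V - {x}" y] G xy by auto
  obtain z w where zw: "{z, w} \<in> D" "z \<in> C" "w \<notin> C"
    by (rule connected_cut[OF G xy(2,1), of C]) (use C in auto)
  have "w = x"
    using zw C reach_closed[of z "{d \<in> D. x \<notin> d}" y w] by (auto simp: C_def)
  then have xz: "{x, z} \<in> D" using zw by (simp add: insert_commute)
  have zy: "z \<noteq> y" using xz xy by auto
  have "connected_graph (V, insert {x, y} D - {{x, z}})"
  proof (rule connected_graphI)
    show "V \<noteq> {}" using xy by auto
  next
    fix S assume S: "S \<subseteq> V" "S \<noteq> {}" "S \<noteq> V"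
    show "\<exists>u\<in>S. \<exists>v\<in>V - S. {u, v} \<in> insert {x, y} D - {{x, z}}"
    proof (cases "x \<in> S \<longleftrightarrow> y \<in> S")
      case False
      have "{x, y} \<noteq> {x, z}" using zy by (auto simp: doubleton_eq_iff)
      then show ?thesis using False xy S by (auto simp: insert_commute)
    next
      case True
      show ?thesis
      proof (cases "y \<in> S \<longleftrightarrow> z \<in> S")
        case yz: True
        obtain p q where pq: "p \<in> V" "q \<in> V" "p \<in> S" "q \<notin> S" using S by blast
        obtain u v where uv: "{u, v} \<in> D" "u \<in> V" "v \<in> V" "u \<in> S" "v \<notin> S"
          by (rule connected_cut[OF G pq])
        have "{u, v} \<noteq> {x, z}" using True yz uv by (auto simp: doubleton_eq_iff)
        then show ?thesis using uv by blast
      next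
        case False
        \<comment> \<open>Here \<open>S\<close> separates \<open>y\<close> from \<open>z\<close>.
          Both lie in the connected set \<open>C\<close>, so some edge inside \<open>C\<close>
          crosses, and it avoids \<open>x\<close>.\<close>
        let ?B = "{d \<in> D. x \<notin> d}"
        have con: "connected_graph (C, {d \<in> ?B. d \<subseteq> C})" unfolding C_def by (rule connected_reach)
        have "\<exists>u\<in>C. \<exists>v\<in>C. u \<in> S \<and> v \<notin> S \<and> {u, v} \<in> D"
        proof (cases "y \<in> S")
          case True
          show ?thesis by (rule connected_cut[OF con _ C(1) zw(2), of S]) (use True False in auto)
        next
          case F: False
          show ?thesis by (rule connected_cut[OF con _ zw(2) C(1), of S]) (use F False in auto)
        qed
        then obtain u v where uv: "u \<in> C" "v \<in> C" "u \<in> S" "v \<notin> S" "{u, v} \<in> D" by blast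
        then have "{u, v} \<noteq> {x, z}" using C by auto
        then show ?thesis using uv C by blast
      qed
    qed
  qed
  then show ?thesis using that xz zy by blast
qed

text \<open>The cycle closed by \<open>{x, y}\<close> has an edge of \<open>D\<close> at each of its
  two ends. They differ because the only edge containing both ends is \<open>{x, y}\<close>
  itself.\<close>

lemma edge_exchange_two:
  assumes G: "connected_graph (V, D)" "simple_graph (V, D)" and e: "x \<in> V" "y \<in> V" "x \<noteq> y" "{x, y} \<notin> D"
  obtains g h where "g \<in> D" "h \<in> D" "g \<noteq> h"
    "connected_graph (V, insert {x, y} (D - {g}))" "connected_graph (V, insert {x, y} (D - {h}))"
proof -
  have D: "D \<subseteq> Pow V" using G by (simp add: simple_graph_iff)
  obtain z where z: "{x, z} \<in> D" "z \<noteq> y" "connected_graph (V, insert {x, y} D - {{x, z}})"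
    using edge_exchange[OF G(1) D e] .
  obtain w where w: "{y, w} \<in> D" "w \<noteq> x" "connected_graph (V, insert {y, x} D - {{y, w}})"
    by (rule edge_exchange[OF G(1) D e(2,1)]) (use e in \<open>auto simp: insert_commute\<close>)
  have ne: "{x, z} \<noteq> {y, w}" using z w e by (auto simp: doubleton_eq_iff)
  show ?thesis
  proof (rule that[OF z(1) w(1) ne])
    show "connected_graph (V, insert {x, y} (D - {{x, z}}))"
      by (rule connected_graph_mono[OF z(3)]) auto
    show "connected_graph (V, insert {x, y} (D - {{y, w}}))"
      by (rule connected_graph_mono[OF w(3)]) (auto simp: insert_commute)
  qed
qed

lemma finite_spanning: "simple_graph (V, E) \<Longrightarrow> finite (spanning (V, E))"
  using simple_graph_finite_edges[of V E] by (auto simp: spanning_def)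

text \<open>A spanning tree \<open>T\<close> plus one edge \<open>e\<close> contains a cycle with at
  least three edges \<open>e\<close>, \<open>g\<close>, \<open>h\<close>. The whole of
  \<open>insert e T\<close> and the three sets obtained by dropping one of these edges are the
  four.\<close>

lemma spanning_ge_4:
  assumes G: "connected_graph (V, E)" "simple_graph (V, E)" and m: "card V \<le> card E"
  shows "card (spanning (V, E)) \<ge> 4"
proof -
  obtain T where T: "T \<subseteq> E" "connected_graph (V, T)" "card T + 1 = card V"
    using spanning_tree_exists[OF G] .
  then have "T \<noteq> E" using m by auto
  then obtain e where e: "e \<in> E" "e \<notin> T" using T by blast
  obtain x y where xy: "e = {x, y}" "x \<noteq> y" "x \<in> V" "y \<in> V" using simple_graph_edgeE[OF G(2) e(1)] .
  obtain g h where gh: "g \<in> T" "h \<in> T" "g \<noteq> h"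
    "connected_graph (V, insert e (T - {g}))" "connected_graph (V, insert e (T - {h}))"
    using edge_exchange_two[OF T(2) simple_graph_mono[OF G(2) T(1)] xy(3,4,2)] e(2) unfolding xy(1) by blast
  let ?F = "{T, insert e T, insert e (T - {g}), insert e (T - {h})}"
  have "?F \<subseteq> spanning (V, E)"
    using T e gh connected_graph_mono[OF T(2), of "insert e T"] by (auto simp: spanning_def)
  moreover have "card ?F = 4"
  proof -
    have "g \<noteq> e" "h \<noteq> e" using gh e by auto
    then have "T \<noteq> insert e T" "T \<noteq> insert e (T - {g})" "T \<noteq> insert e (T - {h})" 
      "insert e T \<noteq> insert e (T - {g})" "insert e T \<noteq> insert e (T - {h})"
      "insert e (T - {g}) \<noteq> insert e (T - {h})" using gh e by blast+
    then show ?thesis by simp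
  qed
  ultimately show ?thesis using card_mono[OF finite_spanning[OF G(2)]] by metis
qed

text \<open>Fix an edge \<open>f\<close> outside a spanning tree \<open>T\<close>. Without
  \<open>f\<close> there is still a cycle, hence four sets, and adding \<open>f\<close> to each
  gives four more. The ninth is \<open>T\<close> with \<open>f\<close> exchanged for a tree edge
  \<open>h\<close>: it stops being connected when \<open>f\<close> is removed, so it is not among
  the eight.\<close>

lemma spanning_ge_9:
  assumes G: "connected_graph (V, E)" "simple_graph (V, E)" and m: "card V < card E"
  shows "card (spanning (V, E)) \<ge> 9"
proof -
  have fE: "finite E" using simple_graph_finite_edges[OF G(2)] .
  obtain T where T: "T \<subseteq> E" "connected_graph (V, T)" "card T + 1 = card V"
    using spanning_tree_exists[OF G] .
  then have "T \<noteq> E" using m by auto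
  then obtain f where f: "f \<in> E" "f \<notin> T" using T by blast
  let ?E = "E - {f}"
  have TE: "T \<subseteq> ?E" using T f by blast
  have con: "connected_graph (V, ?E)" using connected_graph_mono[OF T(2) TE] .
  have sim: "simple_graph (V, ?E)" using simple_graph_mono[OF G(2)] by blast
  have "card ?E = card E - 1" using f fE by simp
  then have four: "card (spanning (V, ?E)) \<ge> 4" using spanning_ge_4[OF con sim] m by simp
  obtain x y where xy: "f = {x, y}" "x \<noteq> y" "x \<in> V" "y \<in> V" using simple_graph_edgeE[OF G(2) f(1)] .
  obtain h where h: "h \<in> T" "connected_graph (V, insert f (T - {h}))"
    using edge_exchange_two[OF T(2) simple_graph_mono[OF G(2) T(1)] xy(3,4,2)] f(2) unfolding xy(1) by blast
  let ?A = "spanning (V, ?E)"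
  have inj: "inj_on (insert f) ?A"
    by (rule inj_on_inverseI[of _ "\<lambda>D. D - {f}"]) (auto simp: spanning_def)
  have "?A \<union> insert f ` ?A \<subseteq> spanning (V, E)"
    using f by (auto simp: spanning_def intro: connected_graph_mono)
  moreover have "?A \<inter> insert f ` ?A = {}" by (auto simp: spanning_def)
  moreover have fA: "finite ?A" using finite_spanning[OF sim] .
  ultimately have c8: "card (?A \<union> insert f ` ?A) \<ge> 8"
    using four by (simp add: card_Un_disjoint card_image[OF inj])
  show ?thesis
  proof (cases "T - {h} \<in> ?A")
    case False
    have "insert f (T - {h}) \<notin> ?A \<union> insert f ` ?A"
    proof
      assume "insert f (T - {h}) \<in> ?A \<union> insert f ` ?A"
      then have "\<exists>D\<in>?A. insert f (T - {h}) = insert f D" by (auto simp: spanning_def)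
      then obtain D where "D \<in> ?A" "insert f (T - {h}) = insert f D" by blast
      moreover have "f \<notin> D" "f \<notin> T - {h}" using \<open>D \<in> ?A\<close> f by (auto simp: spanning_def)
      ultimately have "D = T - {h}" using insert_ident by metis
      then show False using False \<open>D \<in> ?A\<close> by simp
    qed
    moreover have "insert f (T - {h}) \<in> spanning (V, E)" using h f T by (auto simp: spanning_def)
    moreover have "?A \<union> insert f ` ?A \<subseteq> spanning (V, E)" by fact
    ultimately have "card (insert (insert f (T - {h})) (?A \<union> insert f ` ?A)) \<le> card (spanning (V, E))"
      by (intro card_mono finite_spanning[OF G(2)]) auto
    then show ?thesis using c8 fA \<open>insert f (T - {h}) \<notin> _\<close> by simp
  next
    case True
    \<comment> \<open>Contradictory case: a spanning tree inside \<open>T - {h}\<close> would have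
      as many edges as \<open>T\<close>.\<close>
    then have "connected_graph (V, T - {h})" by (simp add: spanning_def)
    moreover have "simple_graph (V, T - {h})" using simple_graph_mono[OF G(2)] T(1) by blast
    ultimately obtain T' where T': "T' \<subseteq> T - {h}" "card T' + 1 = card V"
      by (rule spanning_tree_exists)
    have "T' \<subset> T" using T' h by blast
    then have "card T' < card T" using psubset_card_mono[OF finite_subset[OF T(1) fE]] by blast
    then show ?thesis using T T' by simp
  qed
qed

lemma rooted_ge:
  assumes "connected_graph (V, E)" "simple_graph (V, E)" "v \<in> V"
  shows "card (rooted (V, E) v) \<ge> card V"
proof -
  have "E \<in> spanning (V, E)" using assms by (simp add: spanning_def)
  then have "card (spanning (V, E)) \<ge> 1" using finite_spanning[OF assms(2)]
    by (metis One_nat_def Suc_leI card_gt_0_iff empty_iff)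
  then show ?thesis using card_rooted[OF assms(2,3)] nonspanning_ge(1)[OF assms] by linarith
qed

section \<open>Pendant vertices and subgraphs through a root\<close>

lemma degree_one_edge:
  assumes "degree (V, E) v = 1"
  obtains e where "e \<in> E" "v \<in> e" "\<And>d. d \<in> E \<Longrightarrow> v \<in> d \<Longrightarrow> d = e"
proof -
  have "card {d \<in> E. v \<in> d} = 1" using assms by (simp add: degree_def)
  then obtain e where "{d \<in> E. v \<in> d} = {e}" by (rule card_1_singletonE)
  then show ?thesis using that[of e] by blast
qed

lemma pendant_edge:
  assumes "simple_graph (V, E)" "degree (V, E) v = 1"
  obtains x where "{v, x} \<in> E" "\<And>d. d \<in> E \<Longrightarrow> v \<in> d \<Longrightarrow> d = {v, x}" "x \<noteq> v" "x \<in> V"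
proof -
  obtain e where e: "e \<in> E" "v \<in> e" "\<And>d. d \<in> E \<Longrightarrow> v \<in> d \<Longrightarrow> d = e"
    using degree_one_edge[OF assms(2)] by blast
  obtain p q where "e = {p, q}" "p \<noteq> q" "p \<in> V" "q \<in> V" using simple_graph_edgeE[OF assms(1) e(1)] .
  then have "\<exists>x. e = {v, x} \<and> x \<noteq> v \<and> x \<in> V" using e(2) by (auto simp: insert_commute)
  then obtain x where "e = {v, x}" "x \<noteq> v" "x \<in> V" by blast
  then show ?thesis using that[of x] e by blast
qed

lemma delete_pendant:
  assumes G: "connected_graph (V, E)" "simple_graph (V, E)" and v: "v \<in> V" "degree (V, E) v = 1"
  shows "connected_graph (V - {v}, {e \<in> E. v \<notin> e})" "simple_graph (V - {v}, {e \<in> E. v \<notin> e})"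
    "card (V - {v}) + 1 = card V" "card {e \<in> E. v \<notin> e} + 1 = card E"
proof -
  obtain x where x: "{v, x} \<in> E" "\<And>d. d \<in> E \<Longrightarrow> v \<in> d \<Longrightarrow> d = {v, x}" "x \<noteq> v" "x \<in> V"
    using pendant_edge[OF G(2) v(2)] by blast
  have EV: "E \<subseteq> Pow V" "finite V" using G by (auto simp: simple_graph_iff)
  show "connected_graph (V - {v}, {e \<in> E. v \<notin> e})"
  proof (rule connected_graphI)
    show "V - {v} \<noteq> {}" using x by blast
  next
    fix S assume S: "S \<subseteq> V - {v}" "S \<noteq> {}" "S \<noteq> V - {v}"
    \<comment> \<open>Putting \<open>v\<close> on the side of \<open>x\<close> keeps the pendant
      edge from crossing, so the crossing edge survives the deletion of \<open>v\<close>.\<close>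
    define S' where "S' = (if x \<in> S then insert v S else S)"
    obtain p q where "p \<in> S" "q \<in> V - {v}" "q \<notin> S" using S by blast
    then have pq: "p \<in> V" "q \<in> V" "p \<in> S'" "q \<notin> S'" using S x(3) unfolding S'_def by auto
    obtain a b where ab: "{a, b} \<in> E" "a \<in> V" "b \<in> V" "a \<in> S'" "b \<notin> S'"
      by (rule connected_cut[OF G(1) EV(1) pq])
    have "{a, b} \<noteq> {v, x}" using ab x(3) S by (auto simp: S'_def doubleton_eq_iff split: if_splits)
    then have "v \<notin> {a, b}" using x(2)[of "{a, b}"] ab(1) by blast
    then show "\<exists>u\<in>S. \<exists>w\<in>V - {v} - S. {u, w} \<in> {e \<in> E. v \<notin> e}"
      using ab by (intro bexI[of _ a] bexI[of _ b]) (auto simp: S'_def split: if_splits)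
  qed
  show "simple_graph (V - {v}, {e \<in> E. v \<notin> e})" using G by (auto simp: simple_graph_iff)
  show "card (V - {v}) + 1 = card V" using v EV by (metis Suc_eq_plus1 card_Suc_Diff1)
  have "{e \<in> E. v \<notin> e} = E - {{v, x}}" using x(2) by auto
  then show "card {e \<in> E. v \<notin> e} + 1 = card E" 
    using x simple_graph_finite_edges[OF G(2)] by (metis Suc_eq_plus1 card_Suc_Diff1)
qed

lemma degree_nonzero:
  assumes G: "connected_graph (V, E)" "simple_graph (V, E)" and v: "v \<in> V" and V: "card V \<ge> 2"
  shows "degree (V, E) v \<noteq> 0"
proof
  assume "degree (V, E) v = 0"
  then have none: "{e \<in> E. v \<in> e} = {}"
    using simple_graph_finite_edges[OF G(2)] by (simp add: degree_def)
  have EV: "E \<subseteq> Pow V" using G(2) by (simp add: simple_graph_iff)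
  have "V \<noteq> {v}" using V by auto
  then obtain w where w: "w \<in> V" "w \<notin> {v}" using v by blast
  show False by (rule connected_cut[OF G(1) EV v w(1) _ w(2)]) (use none in auto)
qed

text \<open>A path rooted at an end has only \<open>card V - 1\<close> such subgraphs; a cycle
  somewhere in the graph supplies one more. If the root is pendant, pass to its neighbour in the
  graph without it, which keeps \<open>card V \<le> card E\<close>. Otherwise the root has two edges
  and \<open>nonspanning_ge\<close> applies.\<close>

lemma nonspanning_unicyclic_ge:
  assumes "connected_graph (V, E)" "simple_graph (V, E)" "v \<in> V" "card V \<le> card E"
  shows "card (nonspanning (V, E) v) \<ge> card V"
  using assms
proof (induction "card V" arbitrary: V E v)
  case 0
  then show ?case by (simp add: simple_graph_iff)
next
  case (Suc n)
  note G = Suc.prems(1-3)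
  have fV: "finite V" and fE: "finite E" using G(2) simple_graph_finite_edges by (auto simp: simple_graph_iff)
  show ?case
  proof (cases "degree (V, E) v = 1")
    case True
    obtain x where x: "{v, x} \<in> E" "\<And>d. d \<in> E \<Longrightarrow> v \<in> d \<Longrightarrow> d = {v, x}" "x \<noteq> v" "x \<in> V"
      using pendant_edge[OF G(2) True] by blast
    let ?V = "V - {v}" and ?E = "{e \<in> E. v \<notin> e}"
    note del = delete_pendant[OF G True]
    have IH: "card (nonspanning (?V, ?E) x) \<ge> card ?V"
      using Suc.hyps(1)[of ?V ?E x] del x(3,4) Suc.hyps(2) Suc.prems(4) by auto
    let ?f = "\<lambda>(W, D). (insert v W, insert {v, x} D)"
    let ?N = "nonspanning (?V, ?E) x"
    have sub: "W \<subseteq> ?V" "D \<subseteq> ?E" "D \<subseteq> Pow W" "connected_graph (W, D)" "x \<in> W" "W \<noteq> ?V" if "(W, D) \<in> ?N" for W D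
      using that by (auto simp: nonspanning_def rooted_def conn_subgraphs_def subgraph_def)
    have inj: "inj_on ?f ?N"
    proof (rule inj_on_inverseI[of _ "\<lambda>(W, D). (W - {v}, D - {{v, x}})"])
      fix H assume "H \<in> ?N"
      then show "(case ?f H of (W, D) \<Rightarrow> (W - {v}, D - {{v, x}})) = H"
      proof -
        obtain W D where WD: "H = (W, D)" by (cases H)
        have "v \<notin> W" "{v, x} \<notin> D" using sub[of W D] \<open>H \<in> ?N\<close> WD by auto
        then show ?thesis by (simp add: WD)
      qed
    qed
    have "?f ` ?N \<subseteq> nonspanning (V, E) v"
    proof (rule image_subsetI)
      fix H assume H: "H \<in> ?N"
      obtain W D where WD: "H = (W, D)" by (cases H)
      note s = sub[OF H[unfolded WD]]
      have c: "connected_graph (insert v W, insert {v, x} D)"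
        using connected_graph_insert[OF s(4,3,5), of v] by (simp add: insert_commute)
      have "subgraph (insert v W, insert {v, x} D) (V, E)"
      proof -
        have "W \<subseteq> V" "D \<subseteq> E" "x \<in> W" "\<forall>d\<in>D. d \<subseteq> insert v W" using s by auto
        then show ?thesis using x(1) G(3) by (simp add: subgraph_def)
      qed
      moreover have "insert v W \<noteq> V" using s by auto
      ultimately show "?f H \<in> nonspanning (V, E) v"
        using c by (simp add: WD nonspanning_def rooted_def conn_subgraphs_def)
    qed
    \<comment> \<open>The images all contain the edge to \<open>x\<close>; the single vertex
      \<open>v\<close> is the additional subgraph that accounts for the deleted vertex.\<close>
    moreover have "({v}, {}) \<notin> ?f ` ?N" by auto
    moreover have "({v}, {}) \<in> nonspanning (V, E) v"
    proof -
      have "{v} \<noteq> V" using x(3,4) by auto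
      then show ?thesis using G(3) by (simp add: nonspanning_def rooted_def conn_subgraphs_def subgraph_def connected_graph_singleton)
    qed
    ultimately have "insert ({v}, {}) (?f ` ?N) \<subseteq> nonspanning (V, E) v" by simp
    then have "card (insert ({v}, {}) (?f ` ?N)) \<le> card (nonspanning (V, E) v)"
      using finite_rooted[OF G(2)] by (intro card_mono) (simp_all add: nonspanning_def)
    moreover have "card (insert ({v}, {}) (?f ` ?N)) = Suc (card ?N)"
    proof -
      have "finite ?N" using finite_rooted[OF del(2), of x] by (simp add: nonspanning_def)
      then show ?thesis using \<open>({v}, {}) \<notin> ?f ` ?N\<close> by (simp add: card_image[OF inj])
    qed
    ultimately show ?thesis using IH del(3) by linarith
  next
    case False
    have "card V \<ge> 2"
    proof -
      have "E \<noteq> {}" using Suc.prems(4) Suc.hyps(2) by auto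
      then obtain p q where "p \<noteq> q" "p \<in> V" "q \<in> V" using simple_graph_edgeE[OF G(2)] by blast
      then show ?thesis using card_mono[OF fV, of "{p, q}"] by simp
    qed
    then have "degree (V, E) v \<noteq> 0" by (rule degree_nonzero[OF G])
    then have "card {e \<in> E. v \<in> e} \<ge> 2" using False by (simp add: degree_def)
    then obtain e f where ef: "e \<in> E" "f \<in> E" "v \<in> e" "v \<in> f" "e \<noteq> f"
      by (auto simp: numeral_2_eq_2 card_le_Suc_iff)
    have ex: "\<exists>x. d = {v, x}" if "d \<in> E" "v \<in> d" for d
      by (rule simple_graph_edgeE[OF G(2) that(1)]) (use that(2) in \<open>auto simp: insert_commute\<close>)
    obtain x y where "e = {v, x}" "f = {v, y}" using ex ef by metis
    then show ?thesis using nonspanning_ge(2)[OF G, of x y] ef by auto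
  qed
qed

lemma rooted_unicyclic_ge:
  assumes "connected_graph (V, E)" "simple_graph (V, E)" "v \<in> V" "card V \<le> card E"
  shows "card (rooted (V, E) v) \<ge> card V + 4"
  using card_rooted[OF assms(2,3)] nonspanning_unicyclic_ge[OF assms] spanning_ge_4[OF assms(1,2,4)] by linarith

section \<open>Contracting an edge\<close>

definition merge :: "'a \<Rightarrow> 'a \<Rightarrow> 'a \<Rightarrow> 'a" where
  "merge v a x = (if x = a then v else x)"

text \<open>The contracted edge is removed first because its image would be a singleton. Edges that
  become parallel coincide as sets, so the result is simple.\<close>

definition contract_edges :: "'a set set \<Rightarrow> 'a \<Rightarrow> 'a \<Rightarrow> 'a set set" where
  "contract_edges E v a = (\<lambda>d. merge v a ` d) ` (E - {{v, a}})"

lemma image_Collect_mem: "D \<subseteq> f ` A \<Longrightarrow> f ` {d \<in> A. f d \<in> D} = D"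
  by auto

context
  fixes V :: "'a set" and E :: "'a set set" and v a :: 'a
  assumes sim: "simple_graph (V, E)" and va: "{v, a} \<in> E"
begin

lemma contract_ends: "v \<noteq> a" "v \<in> V" "a \<in> V"
  using simple_graph_noteq[OF sim va] by auto

lemma merge_edge:
  assumes "d \<in> E - {{v, a}}"
  obtains x y where "d = {x, y}" "x \<in> V" "y \<in> V" "x \<noteq> y" "merge v a x \<noteq> merge v a y"
proof -
  obtain x y where xy: "d = {x, y}" "x \<noteq> y" "x \<in> V" "y \<in> V" using simple_graph_edgeE[OF sim] assms by blast
  then have "merge v a x \<noteq> merge v a y" using assms by (auto simp: merge_def split: if_splits)
  then show ?thesis using that xy by blast
qed

lemma simple_contract: "simple_graph (V - {a}, contract_edges E v a)"
proof -
  have "merge v a ` d \<subseteq> V - {a} \<and> card (merge v a ` d) = 2" if d: "d \<in> E - {{v, a}}" for d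
  proof -
    obtain x y where "d = {x, y}" "x \<in> V" "y \<in> V" "merge v a x \<noteq> merge v a y" using merge_edge[OF d] by blast
    moreover have "merge v a x \<in> V - {a}" if "x \<in> V" for x using that contract_ends by (auto simp: merge_def)
    ultimately show ?thesis by simp
  qed
  then show ?thesis using sim by (auto simp: simple_graph_iff contract_edges_def)
qed

lemma connected_contract:
  assumes con: "connected_graph (V, E)"
  shows "connected_graph (V - {a}, contract_edges E v a)"
proof (rule connected_graphI)
  show "V - {a} \<noteq> {}" using contract_ends by blast
next
  fix S assume S: "S \<subseteq> V - {a}" "S \<noteq> {}" "S \<noteq> V - {a}"
  \<comment> \<open>The preimage of a cut has \<open>v\<close> and \<open>a\<close> on the same
    side, so the edge crossing it is not the contracted one.\<close>
  define S' where "S' = {x \<in> V. merge v a x \<in> S}"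
  have EV: "E \<subseteq> Pow V" using sim by (simp add: simple_graph_iff)
  obtain p q where "p \<in> S" "q \<in> V - {a}" "q \<notin> S" using S by blast
  then have pq: "p \<in> V" "q \<in> V" "p \<in> S'" "q \<notin> S'" using S by (auto simp: S'_def merge_def)
  obtain x y where xy: "{x, y} \<in> E" "x \<in> V" "y \<in> V" "x \<in> S'" "y \<notin> S'"
    by (rule connected_cut[OF con EV pq])
  have m: "merge v a x \<in> S" "merge v a y \<notin> S" using xy by (auto simp: S'_def)
  have "{x, y} \<noteq> {v, a}" using m contract_ends by (auto simp: merge_def doubleton_eq_iff)
  then have "merge v a ` {x, y} \<in> contract_edges E v a" using xy unfolding contract_edges_def by blast
  moreover have "merge v a y \<in> V - {a}" using xy contract_ends by (auto simp: merge_def)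
  ultimately show "\<exists>p\<in>S. \<exists>q\<in>V - {a} - S. {p, q} \<in> contract_edges E v a"
    using m by (intro bexI[of _ "merge v a x"] bexI[of _ "merge v a y"]) auto
qed

text \<open>Two edges acquire the same image only if they join \<open>v\<close> and \<open>a\<close>
  to a common neighbour, that is, form a triangle with the contracted edge.\<close>

lemma inj_merge_edges:
  assumes tri: "\<And>c. {v, c} \<in> E \<Longrightarrow> {a, c} \<notin> E"
  shows "inj_on (\<lambda>d. merge v a ` d) (E - {{v, a}})"
proof (rule inj_onI)
  fix d d' assume d: "d \<in> E - {{v, a}}" "d' \<in> E - {{v, a}}" "merge v a ` d = merge v a ` d'"
  obtain x y where xy: "d = {x, y}" "x \<noteq> y" using merge_edge[OF d(1)] by metis
  obtain p q where pq: "d' = {p, q}" "p \<noteq> q" using merge_edge[OF d(2)] by metis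
  \<comment> \<open>The ends of the two edges may match straight or crosswise. The end points are
    free in this claim, so the crosswise case follows by swapping \<open>p\<close> and
    \<open>q\<close>.\<close>
  have *: "d = d'" if eq: "merge v a x = merge v a p" "merge v a y = merge v a q"
    and e: "d = {x, y}" "d' = {p, q}" for x y p q
  proof (rule ccontr)
    assume ne: "d \<noteq> d'"
    have nva: "{x, y} \<noteq> {v, a}" "{p, q} \<noteq> {v, a}" using d e by auto
    have E: "{x, y} \<in> E" "{p, q} \<in> E" "{y, x} \<in> E" "{q, p} \<in> E" using d e by (auto simp: insert_commute)
    show False
    proof (cases "x = p")
      case True
      then have "y \<noteq> q" using ne e by auto
      then have "{y, q} = {v, a}" using eq by (auto simp: merge_def split: if_splits)
      then show False using tri[of x] E True by (auto simp: doubleton_eq_iff)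
    next
      case False
      then have xp: "{x, p} = {v, a}" using eq by (auto simp: merge_def split: if_splits)
      show False
      proof (cases "y = q")
        case True
        then show False using tri[of y] E xp by (auto simp: doubleton_eq_iff)
      next
        case F: False
        then have "{y, q} = {v, a}" using eq by (auto simp: merge_def split: if_splits)
        then have "{x, y} = {v, a} \<or> x = y" using xp by (auto simp: doubleton_eq_iff)
        then show False using nva E(1) simple_graph_noteq[OF sim] by auto
      qed
    qed
  qed
  have "{merge v a x, merge v a y} = {merge v a p, merge v a q}" using d(3) xy pq by simp
  then consider "merge v a x = merge v a p" "merge v a y = merge v a q" | "merge v a x = merge v a q" "merge v a y = merge v a p"
    by (auto simp: doubleton_eq_iff)
  then show "d = d'"
  proof cases
    case 1
    then show ?thesis using * xy pq by blast
  next
    case 2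
    have "d' = {q, p}" using pq by auto
    then show ?thesis using *[OF 2 xy(1)] by blast
  qed
qed

text \<open>The difference between edges and vertices survives, so both induction classes,
  \<open>card E = card V\<close> and \<open>card V < card E\<close>, are closed under such
  contractions.\<close>

lemma card_contract:
  assumes "\<And>c. {v, c} \<in> E \<Longrightarrow> {a, c} \<notin> E"
  shows "card (contract_edges E v a) + 1 = card E" "card (V - {a}) + 1 = card V"
proof -
  have "card (contract_edges E v a) = card (E - {{v, a}})"
    unfolding contract_edges_def by (rule card_image[OF inj_merge_edges[OF assms]])
  then show "card (contract_edges E v a) + 1 = card E"
    using va simple_graph_finite_edges[OF sim] card_Suc_Diff1[of E "{v, a}"] by simp
  show "card (V - {a}) + 1 = card V"
    using contract_ends sim card_Suc_Diff1[of V a] by (simp add: simple_graph_iff)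
qed

text \<open>Away from \<open>v\<close> the edges at a vertex are mapped injectively. At the merged
  vertex, \<open>v\<close> and \<open>a\<close> each contribute an edge other than the contracted
  one, and these keep different images.\<close>

lemma degree_contract:
  assumes tri: "\<And>c. {v, c} \<in> E \<Longrightarrow> {a, c} \<notin> E" and deg: "\<And>x. x \<in> V \<Longrightarrow> degree (V, E) x \<ge> 2"
    and x: "x \<in> V - {a}"
  shows "degree (V - {a}, contract_edges E v a) x \<ge> 2"
proof -
  let ?m = "\<lambda>d. merge v a ` d"
  have fE: "finite E" using simple_graph_finite_edges[OF sim] .
  have card_m: "card (?m ` D) = card D" if "D \<subseteq> E - {{v, a}}" for D
    using card_image inj_on_subset[OF inj_merge_edges[OF tri] that] by blast
  have fin: "finite {d \<in> contract_edges E v a. x \<in> d}" using fE by (simp add: contract_edges_def)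
  show ?thesis
  proof (cases "x = v")
    case False
    let ?D = "{d \<in> E. x \<in> d}"
    have sub: "?D \<subseteq> E - {{v, a}}" using False x by auto
    have "?m ` ?D \<subseteq> {d \<in> contract_edges E v a. x \<in> d}"
    proof (rule image_subsetI)
      fix d assume d: "d \<in> ?D"
      have "merge v a x = x" using x by (simp add: merge_def)
      then have "x \<in> ?m d" using d by (metis imageI mem_Collect_eq)
      then show "?m d \<in> {d \<in> contract_edges E v a. x \<in> d}" using d sub by (auto simp: contract_edges_def)
    qed
    then have "card (?m ` ?D) \<le> card {d \<in> contract_edges E v a. x \<in> d}" using card_mono[OF fin] by blast
    then show ?thesis using card_m[OF sub] deg[of x] x by (simp add: degree_def)
  next
    case True
    have other: "\<exists>d\<in>E - {{v, a}}. z \<in> d" if "z \<in> V" for z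
    proof (rule ccontr)
      assume "\<not> ?thesis"
      then have "{d \<in> E. z \<in> d} \<subseteq> {{v, a}}" by blast
      then have "card {d \<in> E. z \<in> d} \<le> 1" using card_mono[of "{{v, a}}"] by fastforce
      then show False using deg[OF that] by (simp add: degree_def)
    qed
    obtain d1 where d1: "d1 \<in> E - {{v, a}}" "v \<in> d1" using other contract_ends by blast
    obtain d2 where d2: "d2 \<in> E - {{v, a}}" "a \<in> d2" using other contract_ends by blast
    have "d1 \<noteq> d2"
    proof
      assume "d1 = d2"
      moreover obtain p q where "d1 = {p, q}" using merge_edge[OF d1(1)] by metis
      ultimately have "d1 = {v, a}" using d1(2) d2(2) contract_ends(1) by auto
      then show False using d1 by blast
    qed
    then have "card {d1, d2} = 2" by simp
    moreover have "?m ` {d1, d2} \<subseteq> {d \<in> contract_edges E v a. x \<in> d}"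
    proof (rule image_subsetI)
      fix d assume d: "d \<in> {d1, d2}"
      then have "\<exists>z\<in>d. merge v a z = v" using d1 d2 by (auto simp: merge_def)
      then have "v \<in> ?m d" by (metis imageI)
      then show "?m d \<in> {d \<in> contract_edges E v a. x \<in> d}" using d d1 d2 True by (auto simp: contract_edges_def)
    qed
    ultimately show ?thesis using card_m[of "{d1, d2}"] card_mono[OF fin, of "?m ` {d1, d2}"] d1 d2
      by (simp add: degree_def)
  qed
qed

text \<open>A connected subgraph of the contraction is lifted by restoring \<open>a\<close>, the
  edge \<open>{v, a}\<close> and all preimages of its edges if it contains \<open>v\<close>;
  otherwise it is already a subgraph of the original. Merging again undoes the lift, even where
  edges became parallel. A lift uses the edge \<open>{v, a}\<close> or avoids both its ends, so the
  subgraphs in the second summand are new.\<close>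

lemma core_index_contract:
  "core_index (V, E) \<ge> core_index (V - {a}, contract_edges E v a)
    + card {H \<in> conn_subgraphs (V, E - {{v, a}}). v \<in> fst H \<or> a \<in> fst H}"
proof -
  let ?C = "conn_subgraphs (V - {a}, contract_edges E v a)"
  let ?N = "{H \<in> conn_subgraphs (V, E - {{v, a}}). v \<in> fst H \<or> a \<in> fst H}"
  define lift where "lift H = (if v \<in> fst H
      then (insert a (fst H), insert {v, a} {d \<in> E - {{v, a}}. merge v a ` d \<in> snd H}) else H)" for H :: "'a ugraph"
  have sub: "W \<subseteq> V - {a}" "D \<subseteq> contract_edges E v a" "D \<subseteq> Pow W" "connected_graph (W, D)" if "(W, D) \<in> ?C" for W D
    using that by (auto simp: conn_subgraphs_def subgraph_def)
  have lift_in: "lift H \<in> conn_subgraphs (V, E) \<and> lift H \<notin> ?N" if H: "H \<in> ?C" for H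
  proof -
    obtain W D where WD: "H = (W, D)" by (cases H)
    note s = sub[OF H[unfolded WD]]
    show ?thesis
    proof (cases "v \<in> W")
      case True
      let ?L = "insert {v, a} {d \<in> E - {{v, a}}. merge v a ` d \<in> D}"
      have "connected_graph (insert a W, ?L)"
      proof (rule connected_graphI)
        fix S assume S: "S \<subseteq> insert a W" "S \<noteq> {}" "S \<noteq> insert a W"
        show "\<exists>p\<in>S. \<exists>q\<in>insert a W - S. {p, q} \<in> ?L"
        proof (cases "v \<in> S \<longleftrightarrow> a \<in> S")
          case False
          then show ?thesis using True by (auto simp: insert_commute)
        next
          case vS: True
          obtain x y where xy: "x \<in> W" "y \<in> W" "x \<in> S" "y \<notin> S"
            using S vS True by blast
          obtain p q where pq: "{p, q} \<in> D" "p \<in> W" "q \<in> W" "p \<in> S" "q \<notin> S"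
            by (rule connected_cut[OF s(4,3) xy])
          have "{p, q} \<in> (\<lambda>d. merge v a ` d) ` (E - {{v, a}})"
            using subsetD[OF s(2) pq(1)] by (simp only: contract_edges_def)
          then obtain d where d: "merge v a ` d = {p, q}" "d \<in> E - {{v, a}}" by (metis imageE)
          obtain x' y' where d': "d = {x', y'}" using merge_edge[OF d(2)] by metis
          have im: "{merge v a x', merge v a y'} = {p, q}" using d d' by simp
          \<comment> \<open>Merging sends the ends of \<open>d\<close> to \<open>p\<close> and
            \<open>q\<close> in an unknown order, so the claim is made for free end points and used
            in both orders.\<close>
          have *: ?thesis if m: "merge v a x' = p" "merge v a y' = q" and e: "d = {x', y'}" for x' y'
          proof -
            have "x' \<in> S" using m pq vS S by (auto simp: merge_def split: if_splits)
            moreover have "y' \<in> insert a W - S" using m pq vS by (auto simp: merge_def split: if_splits)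
            moreover have "{x', y'} \<in> ?L" using d pq(1) e by simp
            ultimately show ?thesis by blast
          qed
          show ?thesis
            using im *[of x' y'] *[of y' x'] d' by (auto simp: doubleton_eq_iff insert_commute)
        qed
      qed simp
      moreover have "d \<subseteq> insert a W" if "d \<in> ?L" for d
      proof
        fix z assume "z \<in> d"
        show "z \<in> insert a W"
        proof (cases "d = {v, a}")
          case False
          then have "merge v a ` d \<subseteq> W" using that s(3) by blast
          then have "merge v a z \<in> W" using \<open>z \<in> d\<close> by blast
          then show ?thesis by (auto simp: merge_def split: if_splits)
        qed (use \<open>z \<in> d\<close> True in auto)
      qed
      ultimately have "(insert a W, ?L) \<in> conn_subgraphs (V, E)"
        using s(1) va contract_ends by (auto simp: conn_subgraphs_def subgraph_def)
      moreover have "(insert a W, ?L) \<notin> ?N" by (auto simp: conn_subgraphs_def subgraph_def)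
      ultimately show ?thesis using True by (simp add: lift_def WD)
    next
      case False
      have "D \<subseteq> E"
      proof
        fix d assume "d \<in> D"
        then have "d \<in> contract_edges E v a" using s(2) by blast
        then obtain c where c: "c \<in> E" "d = merge v a ` c" by (auto simp: contract_edges_def)
        \<comment> \<open>An edge that misses \<open>v\<close> can only come from an edge that
          misses \<open>a\<close>, and merging does not change such an edge.\<close>
        have "v \<notin> d" using \<open>d \<in> D\<close> s(3) False by blast
        then have "a \<notin> c" using c by (auto simp: merge_def image_iff)
        then have "merge v a ` c = id ` c" by (intro image_cong) (auto simp: merge_def)
        then show "d \<in> E" using c by simp
      qed
      then show ?thesis using False s by (auto simp: lift_def WD conn_subgraphs_def subgraph_def)
    qed
  qed
  have "inj_on lift ?C"
  proof (rule inj_on_inverseI[of _ "\<lambda>(W, D). (W - {a}, (\<lambda>d. merge v a ` d) ` (D - {{v, a}}))"])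
    fix H assume H: "H \<in> ?C"
    obtain W D where WD: "H = (W, D)" by (cases H)
    note s = sub[OF H[unfolded WD]]
    show "(case lift H of (W, D) \<Rightarrow> (W - {a}, (\<lambda>d. merge v a ` d) ` (D - {{v, a}}))) = H"
    proof (cases "v \<in> W")
      case True
      have "insert a W - {a} = W" using s(1) by blast
      moreover have "insert {v, a} {d \<in> E - {{v, a}}. merge v a ` d \<in> D} - {{v, a}} = {d \<in> E - {{v, a}}. merge v a ` d \<in> D}"
        by blast
      moreover have "(\<lambda>d. merge v a ` d) ` {d \<in> E - {{v, a}}. merge v a ` d \<in> D} = D"
        by (rule image_Collect_mem[OF s(2)[unfolded contract_edges_def]])
      ultimately show ?thesis using True by (simp add: lift_def WD)
    next
      case False
      have "W - {a} = W" using s(1) by blast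
      moreover have "(\<lambda>d. merge v a ` d) ` (D - {{v, a}}) = D"
      proof -
        have "{v, a} \<notin> D" using s(3) False by blast
        moreover have "merge v a ` d = d" if "d \<in> D" for d
        proof -
          have "a \<notin> d" using that s(1,3) by blast
          then have "merge v a ` d = id ` d" by (intro image_cong) (auto simp: merge_def)
          then show ?thesis by simp
        qed
        ultimately show ?thesis by simp
      qed
      ultimately show ?thesis using False by (simp add: lift_def WD)
    qed
  qed
  then have "card (lift ` ?C) = card ?C" by (rule card_image)
  moreover have sub: "lift ` ?C \<union> ?N \<subseteq> conn_subgraphs (V, E)"
    using lift_in conn_subgraphs_mono[of V V "E - {{v, a}}" E] by auto
  moreover have "lift ` ?C \<inter> ?N = {}" using lift_in by blast
  moreover have fin: "finite (conn_subgraphs (V, E))" using finite_conn_subgraphs[OF sim] .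
  moreover have "finite (lift ` ?C)" "finite ?N" using finite_subset[OF sub fin] by auto
  ultimately show ?thesis unfolding core_index_eq
    using card_mono[OF fin sub] card_Un_disjoint[of "lift ` ?C" ?N] by linarith
qed

end

section \<open>Graphs on three and five vertices\<close>

text \<open>If no edge crosses \<open>S\<close>, every edge lies inside \<open>S\<close> or misses
  it. Intersecting edges make the same choice, so the links force every edge to the side of
  \<open>x\<close>.\<close>

lemma connected_edge_set:
  assumes x: "x \<in> D" and two: "\<forall>d\<in>D. card d = 2"
    and link: "\<And>y. y \<in> D \<Longrightarrow> \<exists>z\<in>D. x \<inter> z \<noteq> {} \<and> z \<inter> y \<noteq> {}"
  shows "connected_graph (\<Union>D, D)"
proof (rule connected_graphI)
  have "x \<noteq> {}" using x two by fastforce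
  then show "\<Union>D \<noteq> {}" using x by blast
next
  fix S assume S: "S \<subseteq> \<Union>D" "S \<noteq> {}" "S \<noteq> \<Union>D"
  show "\<exists>u\<in>S. \<exists>v\<in>\<Union>D - S. {u, v} \<in> D"
  proof (rule ccontr)
    assume n: "\<not> ?thesis"
    have whole: "d \<subseteq> S \<or> d \<inter> S = {}" if d: "d \<in> D" for d
    proof (rule ccontr)
      assume "\<not> ?thesis"
      then obtain p q where pq: "p \<in> d" "q \<in> d" "p \<in> S" "q \<notin> S" by blast
      then have "d = {p, q}" using two d by (auto simp: card_2_iff)
      then show False using n pq d by blast
    qed
    obtain p y where p: "p \<in> S" "p \<in> y" "y \<in> D" using S by blast
    obtain q y' where q: "q \<notin> S" "q \<in> y'" "y' \<in> D" using S by blast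
    obtain z where z: "z \<in> D" "x \<inter> z \<noteq> {}" "z \<inter> y \<noteq> {}" using link[OF p(3)] by blast
    obtain z' where z': "z' \<in> D" "x \<inter> z' \<noteq> {}" "z' \<inter> y' \<noteq> {}" using link[OF q(3)] by blast
    show False using whole[OF p(3)] whole[OF q(3)] whole[OF z(1)] whole[OF z'(1)] whole[OF x] p q z z' by blast
  qed
qed

text \<open>A connected subgraph with an edge is determined by its edge set, whose union is its
  vertex set; the single vertices come on top. Counting thus reduces to edge sets.\<close>

lemma core_index_ge_edge_sets:
  fixes V :: "'a set"
  assumes "simple_graph (V, E)"
  shows "core_index (V, E) \<ge> card V + card {D. D \<subseteq> E \<and> D \<noteq> {} \<and> connected_graph (\<Union>D, D)}"
proof -
  let ?S = "(\<lambda>v. ({v}, {} :: 'a set set)) ` V" and ?D = "{D. D \<subseteq> E \<and> D \<noteq> {} \<and> connected_graph (\<Union>D, D)}"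
  let ?T = "(\<lambda>D. (\<Union>D, D)) ` ?D"
  have "card ?S = card V" by (rule card_image) (auto simp: inj_on_def)
  moreover have "card ?T = card ?D" by (rule card_image) (auto simp: inj_on_def)
  moreover have "?S \<inter> ?T = {}" by auto
  moreover have fin: "finite (conn_subgraphs (V, E))" using finite_conn_subgraphs[OF assms] .
  moreover have sub: "?S \<union> ?T \<subseteq> conn_subgraphs (V, E)"
  proof -
    have "(\<Union>D, D) \<in> conn_subgraphs (V, E)" if "D \<in> ?D" for D
    proof -
      have "\<Union>D \<subseteq> V" using that assms by (auto simp: simple_graph_iff)
      then show ?thesis using that by (simp add: conn_subgraphs_def subgraph_def Union_upper)
    qed
    moreover have "({v}, {}) \<in> conn_subgraphs (V, E)" if "v \<in> V" for v
      using that by (simp add: conn_subgraphs_def subgraph_def connected_graph_singleton)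
    ultimately show ?thesis by blast
  qed
  moreover have "finite ?S" "finite ?T" using finite_subset[OF sub fin] by auto
  ultimately show ?thesis unfolding core_index_eq
    using card_mono[OF fin sub] card_Un_disjoint[of ?S ?T] by linarith
qed

section \<open>Six edges on five vertices, by evaluation\<close>

datatype v5 = V0 | V1 | V2 | V3 | V4

text \<open>Each edge of the complete graph occurs in one orientation only, so subsequences
  correspond bijectively to edge sets.\<close>

definition pairs5 :: "(v5 \<times> v5) list" where
  "pairs5 = [(V0,V1),(V0,V2),(V0,V3),(V0,V4),(V1,V2),(V1,V3),(V1,V4),(V2,V3),(V2,V4),(V3,V4)]"

fun meets :: "v5 \<times> v5 \<Rightarrow> v5 \<times> v5 \<Rightarrow> bool" where
  "meets (p, q) (r, s) \<longleftrightarrow> p = r \<or> p = s \<or> q = r \<or> q = s"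

text \<open>
  In a connected edge set on five vertices some edge has distance at most two from all others. Only the
  converse is needed: such a central edge makes the edge set connected.
\<close>

definition linked :: "(v5 \<times> v5) list \<Rightarrow> bool" where
  "linked xs \<longleftrightarrow> list_ex (\<lambda>x. list_all (\<lambda>y. list_ex (\<lambda>z. meets x z \<and> meets z y) xs) xs) xs"

text \<open>The house has exactly 49 nonempty connected edge sets; with its five single vertices
  this is 54. The evaluation runs over all 210 choices of six edges, including the disconnected one,
  K_4 with an isolated vertex.\<close>

lemma linked_count_5_6:
  "list_all (\<lambda>es. 49 \<le> length (filter linked (subseqs es))) (filter (\<lambda>es. length es = 6) (subseqs pairs5))"
  by code_simp

lemma distinct_pairs5: "distinct pairs5"
  by code_simp

text \<open>On three vertices any two edges meet, so all 7 nonempty edge sets of the triangle are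
  connected; the three vertices make it 10.\<close>

lemma core_index_3:
  assumes G: "simple_graph (V, E)" and V: "card V = 3" and E: "card E \<ge> 3"
  shows "core_index (V, E) \<ge> 10"
proof -
  have fE: "finite E" using simple_graph_finite_edges[OF G] .
  have fV: "finite V" using G by (simp add: simple_graph_iff)
  have "connected_graph (\<Union>D, D)" if D: "D \<subseteq> E" "D \<noteq> {}" for D
  proof -
    obtain x where x: "x \<in> D" using D by blast
    have two: "\<forall>d\<in>D. card d = 2" using D G by (auto simp: simple_graph_iff)
    have "x \<inter> y \<noteq> {}" if y: "y \<in> D" for y
    proof
      assume "x \<inter> y = {}"
      moreover have xy: "x \<subseteq> V" "y \<subseteq> V" using x y D G by (auto simp: simple_graph_iff)
      ultimately have "card (x \<union> y) = 4" using two x y fV by (simp add: card_Un_disjoint finite_subset)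
      moreover have "card (x \<union> y) \<le> card V" using xy fV by (intro card_mono) auto
      ultimately show False using V by simp
    qed
    then show ?thesis using x by (intro connected_edge_set[OF x two]) blast
  qed
  then have "Pow E - {{}} \<subseteq> {D. D \<subseteq> E \<and> D \<noteq> {} \<and> connected_graph (\<Union>D, D)}" by blast
  then have "card (Pow E - {{}}) \<le> card {D. D \<subseteq> E \<and> D \<noteq> {} \<and> connected_graph (\<Union>D, D)}"
    using fE by (intro card_mono) auto
  moreover have "card (Pow E - {{}}) = 2 ^ card E - 1" using fE by (simp add: card_Pow)
  moreover have "(2::nat) ^ card E \<ge> 2 ^ 3" using E by (intro power_increasing) auto
  ultimately show ?thesis using core_index_ge_edge_sets[OF G] V by simp
qed

lemma core_index_5:
  assumes G: "simple_graph (V, E)" and V: "card V = 5" and E: "card E \<ge> 6"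
  shows "core_index (V, E) \<ge> 54"
proof -
  have fE: "finite E" using simple_graph_finite_edges[OF G] .
  have fV: "finite V" using G by (simp add: simple_graph_iff)
  have U: "(UNIV :: v5 set) = {V0, V1, V2, V3, V4}" using v5.exhaust by blast
  have "card (UNIV :: v5 set) = card V" using V by (simp add: U)
  moreover have "finite (UNIV :: v5 set)" by (simp add: U)
  ultimately obtain g :: "v5 \<Rightarrow> 'a" where g: "bij_betw g UNIV V"
    using fV finite_same_card_bij by blast
  have inj: "g p = g q \<longleftrightarrow> p = q" for p q using g by (auto simp: bij_betw_def inj_def)
  define h where "h = (\<lambda>(p, q). {g p, g q})"
  have h: "h (p, q) = {g p, g q}" for p q by (simp add: h_def)
  have inj_h: "inj_on h (set pairs5)"
    by (auto simp: inj_on_def pairs5_def h doubleton_eq_iff inj)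
  have card_h: "card (h x) = 2" if "x \<in> set pairs5" for x
    using that by (auto simp: pairs5_def h inj)
  have "E \<subseteq> h ` set pairs5"
  proof
    fix d assume "d \<in> E"
    then obtain x y where xy: "d = {x, y}" "x \<noteq> y" "x \<in> V" "y \<in> V" using simple_graph_edgeE[OF G] by blast
    then obtain p q where pq: "x = g p" "y = g q" using g by (auto simp: bij_betw_def)
    then have "p \<noteq> q" using xy by auto
    then have "(p, q) \<in> set pairs5 \<or> (q, p) \<in> set pairs5"
      by (cases p; cases q) (auto simp: pairs5_def)
    moreover have "d = h (p, q)" "d = h (q, p)" using xy pq by (auto simp: h)
    ultimately show "d \<in> h ` set pairs5" by blast
  qed
  \<comment> \<open>Six of the edges suffice: a connected edge set inside \<open>E6\<close> is also
    one inside \<open>E\<close>.\<close>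
  moreover obtain E6 where E6: "E6 \<subseteq> E" "card E6 = 6" using obtain_subset_with_card_n[OF E] by blast
  ultimately have "E6 \<subseteq> h ` set pairs5" by blast
  then obtain P where P: "P \<subseteq> set pairs5" "E6 = h ` P" by (auto simp: subset_image_iff)
  have cP: "card P = 6" using P E6 card_image[OF inj_on_subset[OF inj_h P(1)]] by simp
  have "P \<in> set ` set (subseqs pairs5)" using P(1) by (simp add: subseqs_powset)
  then obtain es where es: "es \<in> set (subseqs pairs5)" "P = set es" by blast
  have des: "distinct es" using subseqs_distinctD[OF es(1) distinct_pairs5] .
  then have "length es = 6" using cP es(2) distinct_card by fastforce
  then have len: "49 \<le> length (filter linked (subseqs es))"
    using linked_count_5_6 es(1) by (simp add: list_all_iff)
  let ?L = "filter linked (subseqs es)"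
  let ?D = "{D. D \<subseteq> E \<and> D \<noteq> {} \<and> connected_graph (\<Union>D, D)}"
  \<comment> \<open>Different subsequences of a list without repetitions have different underlying
    sets, so the length of the filtered list counts edge sets.\<close>
  have "distinct (map set (subseqs es))" using distinct_set_subseqs[OF des] .
  then have inj_set: "inj_on set (set (subseqs es))" "distinct (subseqs es)"
    by (auto simp: distinct_map)
  have "card (set ` set ?L) = card (set ?L)"
    by (rule card_image[OF inj_on_subset[OF inj_set(1)]]) auto
  also have "\<dots> = length ?L" using distinct_card[OF distinct_filter[OF inj_set(2)]] .
  finally have "card (set ` set ?L) = length ?L" .
  moreover have sub: "set ` set ?L \<subseteq> Pow (set pairs5)"
    using subseqs_powset[of es] P es by auto
  moreover have "inj_on (image h) (Pow (set pairs5))"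
    using inj_h by (auto simp: inj_on_def inj_on_image_eq_iff)
  ultimately have card_L: "card (image h ` set ` set ?L) = length ?L"
    by (metis card_image inj_on_subset)
  have "image h ` set ` set ?L \<subseteq> ?D"
  proof (clarify)
    fix xs assume "xs \<in> set ?L"
    then have xs: "xs \<in> set (subseqs es)" "linked xs" by auto
    have "set xs \<in> Pow P" using xs(1) subseqs_powset[of es] es(2) by blast
    then have sP: "set xs \<subseteq> P" by blast
    obtain x where x: "x \<in> set xs" "\<And>y. y \<in> set xs \<Longrightarrow> \<exists>z\<in>set xs. meets x z \<and> meets z y"
      using xs(2) by (auto simp: linked_def list_ex_iff list_all_iff)
    have meet: "h x \<inter> h y \<noteq> {}" if "meets x y" for x y
      using that by (cases x; cases y) (auto simp: h)
    have "connected_graph (\<Union>(h ` set xs), h ` set xs)"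
    proof (rule connected_edge_set)
      show "h x \<in> h ` set xs" using x by blast
      show "\<forall>d\<in>h ` set xs. card d = 2" using card_h sP P by blast
      fix y assume "y \<in> h ` set xs"
      then obtain y' where y': "y' \<in> set xs" "y = h y'" by blast
      obtain z where "z \<in> set xs" "meets x z" "meets z y'" using x(2)[OF y'(1)] by blast
      then show "\<exists>z\<in>h ` set xs. h x \<inter> z \<noteq> {} \<and> z \<inter> y \<noteq> {}"
        using y'(2) by (intro bexI[of _ "h z"] conjI) (simp_all add: meet)
    qed
    moreover have "h ` set xs \<subseteq> E" using sP P E6 by blast
    moreover have "h ` set xs \<noteq> {}" using x(1) by auto
    ultimately show "h ` set xs \<subseteq> E \<and> h ` set xs \<noteq> {} \<and> connected_graph (\<Union>(h ` set xs), h ` set xs)"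
      by (intro conjI)
  qed
  moreover have "finite ?D" using finite_subset[of ?D "Pow E"] fE by auto
  ultimately have "card (image h ` set ` set ?L) \<le> card ?D" by (intro card_mono)
  then show ?thesis using core_index_ge_edge_sets[OF G] V len card_L by simp
qed

section \<open>Lower bounds\<close>

text \<open>Grow \<open>S\<close> from one vertex, for which equality holds. An edge leaving
  \<open>S\<close> lies in a triangle: if the third vertex is in \<open>S\<close>, one vertex and
  two edges are gained, otherwise two vertices and three edges. Neither increases 3 times the
  vertices minus 2 times the edges, so a largest such \<open>S\<close> is all of
  \<open>V\<close>.\<close>

lemma edges_in_triangles:
  assumes G: "connected_graph (V, E)" "simple_graph (V, E)"
    and tri: "\<And>u w. {u, w} \<in> E \<Longrightarrow> \<exists>c. {u, c} \<in> E \<and> {w, c} \<in> E"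
  shows "3 * card V \<le> 2 * card E + 3"
proof -
  have fV: "finite V" and fE: "finite E" and EV: "E \<subseteq> Pow V"
    using G(2) simple_graph_finite_edges[OF G(2)] by (auto simp: simple_graph_iff)
  let ?I = "\<lambda>S. {e \<in> E. e \<subseteq> S}"
  let ?P = "\<lambda>S. S \<subseteq> V \<and> S \<noteq> {} \<and> 3 * card S \<le> 2 * card (?I S) + 3"
  obtain r where r: "r \<in> V" using G(1) connected_graph_nonempty by blast
  define P where "P = ?P"
  have "P {r}" using r by (simp add: P_def)
  moreover have "\<forall>S. P S \<longrightarrow> card S < Suc (card V)" using fV by (auto simp: P_def less_Suc_eq_le intro: card_mono)
  ultimately obtain S where PS: "P S" and Pmax: "\<forall>T. P T \<longrightarrow> card T \<le> card S"
    using ex_has_greatest_nat[of P "{r}" card "Suc (card V)"] by blast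
  then have S: "?P S" and max: "\<And>T. ?P T \<Longrightarrow> card T \<le> card S" by (simp_all add: P_def)
  have fS: "finite S" using S fV finite_subset by blast
  have "S = V"
  proof (rule ccontr)
    assume "S \<noteq> V"
    then obtain p q where pq: "p \<in> V" "q \<in> V" "p \<in> S" "q \<notin> S" using S by blast
    obtain u w where uw: "{u, w} \<in> E" "u \<in> V" "w \<in> V" "u \<in> S" "w \<notin> S"
      by (rule connected_cut[OF G(1) EV pq])
    obtain c where c: "{u, c} \<in> E" "{w, c} \<in> E" using tri[OF uw(1)] by blast
    have cV: "c \<in> V" "c \<noteq> u" "c \<noteq> w" using c simple_graph_noteq[OF G(2)] by blast+
    show False
    proof (cases "c \<in> S")
      case True
      let ?T = "insert w S"
      have "insert {u, w} (insert {w, c} (?I S)) \<subseteq> ?I ?T" using uw c True by auto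
      then have "card (insert {u, w} (insert {w, c} (?I S))) \<le> card (?I ?T)" using fE by (intro card_mono) auto
      moreover have "{u, w} \<noteq> {w, c}" using cV uw by (auto simp: doubleton_eq_iff)
      ultimately have "card (?I S) + 2 \<le> card (?I ?T)" using uw fE by simp
      then have "?P ?T" using S uw fS by auto
      then show False using max[of ?T] uw fS by simp
    next
      case False
      let ?T = "insert c (insert w S)"
      have "insert {u, w} (insert {w, c} (insert {u, c} (?I S))) \<subseteq> ?I ?T" using uw c by auto
      then have "card (insert {u, w} (insert {w, c} (insert {u, c} (?I S)))) \<le> card (?I ?T)" using fE by (intro card_mono) auto
      moreover have "{u, w} \<noteq> {w, c}" "{u, w} \<noteq> {u, c}" "{w, c} \<noteq> {u, c}" using cV uw by (auto simp: doubleton_eq_iff)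
      ultimately have "card (?I S) + 3 \<le> card (?I ?T)" using uw fE False by simp
      then have "?P ?T" using S uw fS False cV by auto
      then show False using max[of ?T] uw fS False cV by simp
    qed
  qed
  moreover have "?I V = E" using EV by blast
  ultimately show ?thesis using S by simp
qed

section \<open>Estimates for the loss under contraction\<close>

text \<open>The loss splits into two disjoint families: subgraphs through \<open>v\<close>, and
  subgraphs through \<open>a\<close> inside a set \<open>W\<close> that misses
  \<open>v\<close>.\<close>

lemma card_two_roots:
  assumes G: "simple_graph (V, K)" and X: "X \<subseteq> V" "D \<subseteq> K" and W: "W \<subseteq> V" "D' \<subseteq> K" "v \<notin> W"
  shows "card (rooted (X, D) v) + card (rooted (W, D') a)
    \<le> card {H \<in> conn_subgraphs (V, K). v \<in> fst H \<or> a \<in> fst H}"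
proof -
  let ?N = "{H \<in> conn_subgraphs (V, K). v \<in> fst H \<or> a \<in> fst H}"
  have sub: "rooted (X, D) v \<union> rooted (W, D') a \<subseteq> ?N"
    using conn_subgraphs_mono[OF X] conn_subgraphs_mono[OF W(1,2)] by (auto simp: rooted_def)
  have fin: "finite ?N" using finite_conn_subgraphs[OF G] by simp
  have "rooted (X, D) v \<inter> rooted (W, D') a = {}"
    using W(3) by (auto simp: rooted_def conn_subgraphs_def subgraph_def)
  moreover have "finite (rooted (X, D) v)" "finite (rooted (W, D') a)" using finite_subset[OF sub fin] by auto
  ultimately show ?thesis
    using card_mono[OF fin sub] card_Un_disjoint[of "rooted (X, D) v" "rooted (W, D') a"] by linarith
qed

lemma bridge_sides:
  assumes G: "connected_graph (V, E)" "simple_graph (V, E)" and va: "{v, a} \<in> E"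
    and bridge: "\<not> connected_graph (V, E - {{v, a}})"
  defines "K \<equiv> E - {{v, a}}"
  shows "reach K v \<inter> reach K a = {}" "reach K v \<union> reach K a = V"
proof -
  have EV: "E \<subseteq> Pow V" using G(2) by (simp add: simple_graph_iff)
  have ends: "v \<noteq> a" "v \<in> V" "a \<in> V" using simple_graph_noteq[OF G(2) va] by auto
  let ?A = "reach K v" and ?B = "reach K a"
  have AV: "?A \<subseteq> V" "?B \<subseteq> V" using reach_subset[of K V] EV ends by (auto simp: K_def)
  have self: "v \<in> ?A" "a \<in> ?B" by (rule reach_self)+
  \<comment> \<open>A set with both \<open>v\<close> and \<open>a\<close> inside is not crossed by
    the bridge, so it is left by an edge of \<open>K\<close>.\<close>
  have step: "\<exists>x y. {x, y} \<in> K \<and> x \<in> S \<and> y \<notin> S" if S: "S \<subseteq> V" "S \<noteq> V" "v \<in> S" "a \<in> S" for S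
  proof -
    obtain q where q: "q \<in> V" "q \<notin> S" using S by blast
    obtain x y where xy: "{x, y} \<in> E" "x \<in> S" "y \<notin> S"
      by (rule connected_cut[OF G(1) EV ends(2) q(1) S(3) q(2)])
    then have "{x, y} \<noteq> {v, a}" using S by (auto simp: doubleton_eq_iff)
    then show ?thesis using xy unfolding K_def by blast
  qed
  have aA: "a \<notin> ?A"
  proof
    assume "a \<in> ?A"
    have "?A = V"
    proof (rule ccontr)
      assume "?A \<noteq> V"
      then show False using step[OF AV(1)] self \<open>a \<in> ?A\<close> reach_closed[of _ K v] by blast
    qed
    moreover have "{d \<in> K. d \<subseteq> V} = K" using EV by (auto simp: K_def)
    ultimately have "connected_graph (V, K)" using connected_reach[of K v] by simp
    then show False using bridge by (simp add: K_def)
  qed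
  show "?A \<union> ?B = V"
  proof (rule ccontr)
    assume "?A \<union> ?B \<noteq> V"
    then have "\<exists>x y. {x, y} \<in> K \<and> x \<in> ?A \<union> ?B \<and> y \<notin> ?A \<union> ?B" using AV self by (intro step) auto
    then obtain x y where "{x, y} \<in> K" "x \<in> ?A \<union> ?B" "y \<notin> ?A \<union> ?B" by blast
    then show False using reach_closed[of x K v y] reach_closed[of x K a y] by blast
  qed
  show "?A \<inter> ?B = {}"
  proof (rule ccontr)
    assume "?A \<inter> ?B \<noteq> {}"
    then obtain x where x: "x \<in> ?A" "x \<in> ?B" by blast
    obtain p q where "{p, q} \<in> {e \<in> K. e \<subseteq> ?B}" "p \<in> ?A" "q \<notin> ?A"
      by (rule connected_cut[OF connected_reach _ x(2) self(2) x(1) aA]) auto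
    then show False using reach_closed[of p K v q] by blast
  qed
qed

text \<open>Inside the side \<open>A\<close> only \<open>v\<close> loses an edge, so the degree sum
  is at least \<open>2 * card A - 1\<close>. Being twice the number of edges, it is even, which
  gives the missing one.\<close>

lemma bridge_side_unicyclic:
  assumes sim: "simple_graph (V, E)" and va: "{v, a} \<in> E"
    and deg: "\<And>x. x \<in> V \<Longrightarrow> degree (V, E) x \<ge> 2"
    and a: "a \<notin> reach (E - {{v, a}}) v"
  defines "A \<equiv> reach (E - {{v, a}}) v"
  shows "card A \<le> card {d \<in> E - {{v, a}}. d \<subseteq> A}"
proof -
  let ?K = "E - {{v, a}}"
  let ?D = "{d \<in> ?K. d \<subseteq> A}"
  have ends: "v \<noteq> a" "v \<in> V" "a \<in> V" using simple_graph_noteq[OF sim va] by auto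
  have EV: "E \<subseteq> Pow V" and fV: "finite V" using sim by (auto simp: simple_graph_iff)
  have fE: "finite E" using simple_graph_finite_edges[OF sim] .
  have AV: "A \<subseteq> V" unfolding A_def using reach_subset[of ?K V v] EV ends by auto
  have fA: "finite A" using AV fV finite_subset by blast
  have vA: "v \<in> A" unfolding A_def by (rule reach_self)
  have simA: "simple_graph (A, ?D)" using simple_graph_induced[OF simple_graph_mono[OF sim, of ?K] AV] by auto
  have inside: "d \<subseteq> A" if d: "d \<in> ?K" "x \<in> d" "x \<in> A" for d x
  proof -
    obtain p q where pq: "d = {p, q}" using simple_graph_edgeE[OF sim, of d] d(1) by blast
    then show ?thesis using d reach_closed[of p ?K v q] reach_closed[of q ?K v p]
      by (auto simp: A_def insert_commute)
  qed
  have degA: "degree (A, ?D) x \<ge> (if x = v then 1 else 2)" if x: "x \<in> A" for x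
  proof -
    have dx: "card {d \<in> E. x \<in> d} \<ge> 2" using deg[of x] x AV by (auto simp: degree_def)
    have fin: "finite {d \<in> ?D. x \<in> d}" using fE by simp
    show ?thesis
    proof (cases "x = v")
      case True
      have "{d \<in> E. x \<in> d} \<subseteq> insert {v, a} {d \<in> ?D. x \<in> d}" using inside x by blast
      then have "card {d \<in> E. x \<in> d} \<le> card (insert {v, a} {d \<in> ?D. x \<in> d})" using fin by (intro card_mono) auto
      also have "\<dots> \<le> Suc (card {d \<in> ?D. x \<in> d})" using fin by (simp add: card_insert_if)
      finally show ?thesis using dx True by (simp add: degree_def)
    next
      case False
      then have "x \<notin> {v, a}" using x a by (auto simp: A_def)
      then have "{d \<in> E. x \<in> d} \<subseteq> {d \<in> ?D. x \<in> d}" using inside x by blast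
      then have "card {d \<in> E. x \<in> d} \<le> card {d \<in> ?D. x \<in> d}" using fin by (intro card_mono)
      then show ?thesis using dx False by (simp add: degree_def)
    qed
  qed
  have "(\<Sum>x\<in>A. if x = v then 1 else 2) \<le> (\<Sum>x\<in>A. degree (A, ?D) x)" by (intro sum_mono degA)
  also have "\<dots> = 2 * card ?D" by (rule handshake[OF simA])
  finally have "(\<Sum>x\<in>A. if x = v then 1 else 2 :: nat) \<le> 2 * card ?D" .
  moreover have "(\<Sum>x\<in>A. if x = v then 1 else 2 :: nat) + 1 = 2 * card A"
  proof -
    have "(\<Sum>x\<in>A. if x = v then 1 else 2 :: nat) = 1 + (\<Sum>x\<in>A - {v}. if x = v then 1 else 2 :: nat)"
      using sum.remove[OF fA vA, of "\<lambda>x. if x = v then 1 else 2 :: nat"] by simp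
    also have "(\<Sum>x\<in>A - {v}. if x = v then 1 else 2 :: nat) = (\<Sum>x\<in>A - {v}. 2)" by (rule sum.cong) auto
    also have "\<dots> = 2 * (card A - 1)" using vA fA by simp
    finally have "(\<Sum>x\<in>A. if x = v then 1 else 2 :: nat) = 1 + 2 * (card A - 1)" .
    moreover have "card A \<ge> 1" using vA fA by (simp add: Suc_le_eq card_gt_0_iff) blast
    ultimately show ?thesis by linarith
  qed
  ultimately show ?thesis by linarith
qed

lemma connected_join:
  assumes A: "connected_graph (W, D)" "D \<subseteq> Pow W" "v \<in> W"
    and B: "connected_graph (W', D')" "D' \<subseteq> Pow W'" "a \<in> W'"
  shows "connected_graph (W \<union> W', insert {v, a} (D \<union> D'))"
proof (rule connected_graphI)
  show "W \<union> W' \<noteq> {}" using A by blast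
next
  fix S assume S: "S \<subseteq> W \<union> W'" "S \<noteq> {}" "S \<noteq> W \<union> W'"
  show "\<exists>p\<in>S. \<exists>q\<in>W \<union> W' - S. {p, q} \<in> insert {v, a} (D \<union> D')"
  proof (cases "\<exists>x\<in>W. \<exists>y\<in>W. x \<in> S \<and> y \<notin> S")
    case True
    then obtain x y where xy: "x \<in> W" "y \<in> W" "x \<in> S" "y \<notin> S" by blast
    show ?thesis by (rule connected_cut[OF A(1,2) xy]) blast
  next
    case F: False
    show ?thesis
    proof (cases "\<exists>x\<in>W'. \<exists>y\<in>W'. x \<in> S \<and> y \<notin> S")
      case True
      then obtain x y where xy: "x \<in> W'" "y \<in> W'" "x \<in> S" "y \<notin> S" by blast
      show ?thesis by (rule connected_cut[OF B(1,2) xy]) blast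
    next
      case False
      then have "v \<in> S \<longleftrightarrow> a \<notin> S" using F S A(3) B(3) by blast
      then show ?thesis using A(3) B(3) by (auto simp: insert_commute)
    qed
  qed
qed

text \<open>A connected subgraph lies in one side or, when it uses the bridge, is a pair of rooted
  subgraphs joined by it. This direct count serves bridges on six vertices, where contraction loses
  too little.\<close>

lemma core_index_bridge:
  fixes V :: "'a set"
  assumes G: "simple_graph (V, E)" and va: "{v, a} \<in> E" 
    and A: "A \<subseteq> V" "D \<subseteq> E" "v \<in> A" "D \<subseteq> Pow A" and B: "B \<subseteq> V" "D' \<subseteq> E" "a \<in> B" "D' \<subseteq> Pow B"
    and disj: "A \<inter> B = {}" 
  shows "core_index (V, E) \<ge> core_index (A, D) + core_index (B, D')
    + card (rooted (A, D) v) * card (rooted (B, D') a)"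
proof -
  let ?X = "conn_subgraphs (A, D)" and ?Y = "conn_subgraphs (B, D')"
  let ?P = "rooted (A, D) v \<times> rooted (B, D') a"
  let ?j = "\<lambda>(H, H'). (fst H \<union> fst H', insert {v, a} (snd H \<union> snd H')) :: 'a ugraph"
  have fin: "finite (conn_subgraphs (V, E))" using finite_conn_subgraphs[OF G] .
  have X: "?X \<subseteq> conn_subgraphs (V, E)" and Y: "?Y \<subseteq> conn_subgraphs (V, E)"
    by (rule conn_subgraphs_mono[OF A(1,2)], rule conn_subgraphs_mono[OF B(1,2)])
  have va': "\<not> {v, a} \<subseteq> A" "\<not> {v, a} \<subseteq> B" using A B disj by auto
  have P: "?j ` ?P \<subseteq> conn_subgraphs (V, E)"
  proof (rule image_subsetI)
    fix HH assume "HH \<in> ?P"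
    then obtain W F W' F' where HH: "HH = ((W, F), (W', F'))" "(W, F) \<in> rooted (A, D) v" "(W', F') \<in> rooted (B, D') a"
      by (metis SigmaE prod.exhaust)
    then have s: "W \<subseteq> A" "F \<subseteq> D" "F \<subseteq> Pow W" "connected_graph (W, F)" "v \<in> W"
      "W' \<subseteq> B" "F' \<subseteq> D'" "F' \<subseteq> Pow W'" "connected_graph (W', F')" "a \<in> W'"
      by (auto simp: rooted_def conn_subgraphs_def subgraph_def)
    have "connected_graph (W \<union> W', insert {v, a} (F \<union> F'))" by (rule connected_join) fact+
    moreover have "subgraph (W \<union> W', insert {v, a} (F \<union> F')) (V, E)"
    proof -
      have "W \<subseteq> V" "W' \<subseteq> V" "F \<subseteq> E" "F' \<subseteq> E" using s(1,2,6,7) A(1,2) B(1,2) by (meson order_trans)+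
      then have "W \<union> W' \<subseteq> V" "insert {v, a} (F \<union> F') \<subseteq> E" using va by simp_all
      moreover have "\<forall>d\<in>insert {v, a} (F \<union> F'). d \<subseteq> W \<union> W'" using s(3,5,8,10) by auto
      ultimately show ?thesis by (simp add: subgraph_def)
    qed
    ultimately show "?j HH \<in> conn_subgraphs (V, E)" by (simp add: HH conn_subgraphs_def)
  qed
  have inj: "inj_on ?j ?P"
  \<comment> \<open>Sorting vertices and edges by side recovers both parts: the bridge lies in
    neither side, and no edge is empty.\<close>
  proof (rule inj_on_inverseI[of _ "\<lambda>(W, F). ((W \<inter> A, {d \<in> F. d \<subseteq> A}), (W \<inter> B, {d \<in> F. d \<subseteq> B}))"])
    fix HH assume "HH \<in> ?P"
    then obtain W F W' F' where HH: "HH = ((W, F), (W', F'))" "(W, F) \<in> rooted (A, D) v" "(W', F') \<in> rooted (B, D') a"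
      by (metis SigmaE prod.exhaust)
    then have s: "W \<subseteq> A" "F \<subseteq> D" "W' \<subseteq> B" "F' \<subseteq> D'"
      by (auto simp: rooted_def conn_subgraphs_def subgraph_def)
    have ne: "d \<noteq> {}" if "d \<in> E" for d
    proof -
      have "card d = 2" using that G by (simp add: simple_graph_iff)
      then show ?thesis by auto
    qed
    have FA: "d \<subseteq> A \<and> d \<noteq> {}" if "d \<in> F" for d
      using subsetD[OF s(2) that] A(2,4) ne by blast
    have FB: "d \<subseteq> B \<and> d \<noteq> {}" if "d \<in> F'" for d
      using subsetD[OF s(4) that] B(2,4) ne by blast
    have dB: "\<not> d \<subseteq> B" if "d \<in> F" for d using FA[OF that] disj by blast
    have dA: "\<not> d \<subseteq> A" if "d \<in> F'" for d using FB[OF that] disj by blast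
    have "(W \<union> W') \<inter> A = W" "(W \<union> W') \<inter> B = W'" using s(1,3) disj by blast+
    moreover have "{d \<in> insert {v, a} (F \<union> F'). d \<subseteq> A} = F" using va'(1) dA FA by auto
    moreover have "{d \<in> insert {v, a} (F \<union> F'). d \<subseteq> B} = F'" using va'(2) dB FB by auto
    ultimately show "(case ?j HH of (W, F) \<Rightarrow> ((W \<inter> A, {d \<in> F. d \<subseteq> A}), (W \<inter> B, {d \<in> F. d \<subseteq> B}))) = HH"
      by (simp add: HH)
  qed
  have "?X \<inter> ?Y = {}"
  proof -
    have "fst H \<noteq> {}" if "H \<in> ?X" for H using that by (auto simp: conn_subgraphs_def connected_graph_def)
    moreover have "fst H \<subseteq> A" if "H \<in> ?X" for H using that by (auto simp: conn_subgraphs_def subgraph_def)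
    moreover have "fst H \<subseteq> B" if "H \<in> ?Y" for H using that by (auto simp: conn_subgraphs_def subgraph_def)
    ultimately show ?thesis using disj by blast
  qed
  moreover have "(?X \<union> ?Y) \<inter> ?j ` ?P = {}"
  proof -
    have "{v, a} \<notin> snd H" if "H \<in> ?X \<union> ?Y" for H
      using that va' A(4) B(4) by (auto simp: conn_subgraphs_def subgraph_def)
    moreover have "{v, a} \<in> snd H" if "H \<in> ?j ` ?P" for H using that by auto
    ultimately show ?thesis by blast
  qed
  moreover have "finite ?X" "finite ?Y" "finite (?j ` ?P)" using X Y P fin finite_subset by blast+
  ultimately have "card ((?X \<union> ?Y) \<union> ?j ` ?P) = card ?X + card ?Y + card (?j ` ?P)"
    by (simp add: card_Un_disjoint)
  moreover have "card (?j ` ?P) = card (rooted (A, D) v) * card (rooted (B, D') a)"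
    by (simp add: card_image[OF inj] card_cartesian_product)
  moreover have "card ((?X \<union> ?Y) \<union> ?j ` ?P) \<le> card (conn_subgraphs (V, E))"
    using X Y P by (intro card_mono[OF fin]) blast
  ultimately show ?thesis unfolding core_index_eq by linarith
qed

text \<open>\<open>A\<close> is the component of \<open>a\<close> after removal of \<open>v\<close>;
  it can be left only through \<open>v\<close>. The subgraphs through \<open>a\<close> inside
  \<open>A\<close> are to be counted next to those through \<open>v\<close>.\<close>

lemma avoiding_reach:
  assumes G: "simple_graph (V, K)" "v \<in> V" "a \<in> V" "v \<noteq> a"
  defines "A \<equiv> reach {d \<in> K. v \<notin> d} a"
  shows "a \<in> A" "A \<subseteq> V - {v}" "\<And>p q. {p, q} \<in> K \<Longrightarrow> p \<in> A \<Longrightarrow> q \<notin> A \<Longrightarrow> q = v"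
    "card (rooted (A, {d \<in> {d \<in> K. v \<notin> d}. d \<subseteq> A}) a) \<ge> card A"
proof -
  let ?K = "{d \<in> K. v \<notin> d}"
  have KV: "K \<subseteq> Pow V" using G(1) by (simp add: simple_graph_iff)
  show aA: "a \<in> A" unfolding A_def by (rule reach_self)
  show AV: "A \<subseteq> V - {v}" unfolding A_def using KV G by (intro reach_subset) auto
  show "q = v" if pq: "{p, q} \<in> K" "p \<in> A" "q \<notin> A" for p q
  proof (rule ccontr)
    assume "q \<noteq> v"
    moreover have "p \<noteq> v" using AV pq(2) by blast
    ultimately have "{p, q} \<in> ?K" using pq(1) by simp
    then show False using reach_closed[of p ?K a q] pq(2,3) by (simp add: A_def)
  qed
  have sim: "simple_graph (V, ?K)" by (rule simple_graph_mono[OF G(1)]) blast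
  have con: "connected_graph (A, {d \<in> ?K. d \<subseteq> A})" unfolding A_def by (rule connected_reach)
  have "simple_graph (A, {d \<in> ?K. d \<subseteq> A})" by (rule simple_graph_induced[OF sim]) (use AV in blast)
  then show "card (rooted (A, {d \<in> ?K. d \<subseteq> A}) a) \<ge> card A" using rooted_ge[OF con _ aA] by blast
qed

text \<open>\<open>card V + 4\<close> comes from the subgraphs through \<open>v\<close>, since
  \<open>K\<close> still has a cycle; the last summand comes from those through \<open>a\<close>
  that avoid \<open>v\<close>.\<close>

lemma card_roots_ge:
  assumes con: "connected_graph (V, K)" and G: "simple_graph (V, K)" "v \<in> V" "a \<in> V" "v \<noteq> a"
    and m: "card V \<le> card K"
  shows "card V + 4 + card (reach {d \<in> K. v \<notin> d} a)
    \<le> card {H \<in> conn_subgraphs (V, K). v \<in> fst H \<or> a \<in> fst H}"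
proof -
  let ?A = "reach {d \<in> K. v \<notin> d} a"
  note A = avoiding_reach[OF G]
  have "card (rooted (V, K) v) + card (rooted (?A, {d \<in> {d \<in> K. v \<notin> d}. d \<subseteq> ?A}) a)
    \<le> card {H \<in> conn_subgraphs (V, K). v \<in> fst H \<or> a \<in> fst H}"
    using A(2) by (intro card_two_roots[OF G(1)]) auto
  then show ?thesis using A(4) rooted_unicyclic_ge[OF con G(1,2) m] by linarith
qed

text \<open>The two components cover \<open>V\<close>, since their union could be left only through
  \<open>v\<close> or \<open>a\<close>, which belong to it. They overlap because \<open>v\<close>
  has a neighbour \<open>p\<close> in \<open>?A\<close> other than \<open>a\<close>, and
  \<open>p\<close> then lies in \<open>?B\<close> too. So at least one of them contains more than
  half of the vertices.\<close>

lemma avoiding_reach_sides: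
  assumes con: "connected_graph (V, K)" and G: "simple_graph (V, K)" "v \<in> V" "a \<in> V" "v \<noteq> a"
    and va: "{v, a} \<notin> K"
  shows "card V < card (reach {d \<in> K. v \<notin> d} a) + card (reach {d \<in> K. a \<notin> d} v)"
proof -
  let ?A = "reach {d \<in> K. v \<notin> d} a" and ?B = "reach {d \<in> K. a \<notin> d} v"
  have KV: "K \<subseteq> Pow V" and fV: "finite V" using G(1) by (auto simp: simple_graph_iff)
  note A = avoiding_reach[OF G] and B = avoiding_reach[OF G(1,3,2) G(4)[symmetric]]
  have U: "?A \<union> ?B = V"
  proof (rule ccontr)
    assume "?A \<union> ?B \<noteq> V"
    then obtain z where z: "z \<in> V" "z \<notin> ?A \<union> ?B" using A(2) B(2) by blast
    have aU: "a \<in> ?A \<union> ?B" using A(1) by blast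
    obtain p q where pq: "{p, q} \<in> K" "p \<in> ?A \<union> ?B" "q \<notin> ?A \<union> ?B"
      by (rule connected_cut[OF con KV G(3) z(1) aU z(2)])
    then have "q = v \<or> q = a" using A(3)[OF pq(1)] B(3)[OF pq(1)] by blast
    then show False using pq(3) A(1) B(1) by blast
  qed
  have vA: "v \<notin> ?A" using A(2) by blast
  obtain p q where pq: "{p, q} \<in> K" "p \<in> ?A" "q \<notin> ?A"
    by (rule connected_cut[OF con KV G(3,2) A(1) vA])
  have "q = v" using A(3)[OF pq] .
  have "p \<noteq> a" using pq(1) va \<open>q = v\<close> by (auto simp: insert_commute)
  then have "p \<in> ?B" using B(3)[of v p] pq(1) B(1) \<open>q = v\<close> by (auto simp: insert_commute)
  then have "?A \<inter> ?B \<noteq> {}" using pq(2) by blast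
  moreover have fin: "finite ?A" "finite ?B" using A(2) B(2) fV finite_subset by blast+
  ultimately have "card (?A \<inter> ?B) \<ge> 1" by (simp add: Suc_le_eq card_gt_0_iff)
  then show ?thesis using card_Un_Int[OF fin] U by simp
qed

text \<open>A vertex \<open>z\<close> outside \<open>A\<close> and different from \<open>v\<close>
  has, by its degree, a neighbour \<open>y\<close> other than \<open>v\<close>. As \<open>A\<close>
  can be left only through \<open>v\<close>, also \<open>y\<close> is outside, and \<open>v\<close>,
  \<open>y\<close>, \<open>z\<close> are the three missing vertices.\<close>

lemma avoiding_reach_small:
  assumes G: "simple_graph (V, E)" "{v, a} \<in> E"
    and deg: "\<And>x. x \<in> V \<Longrightarrow> degree (V, E) x \<ge> 2"
  defines "A \<equiv> reach {d \<in> E - {{v, a}}. v \<notin> d} a"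
  assumes ne: "A \<noteq> V - {v}"
  shows "card A + 3 \<le> card V"
proof -
  let ?K = "E - {{v, a}}"
  have ends: "v \<noteq> a" "v \<in> V" "a \<in> V" using simple_graph_noteq[OF G] by auto
  have simK: "simple_graph (V, ?K)" by (rule simple_graph_mono[OF G(1)]) blast
  note A = avoiding_reach[OF simK ends(2,3,1), folded A_def]
  have fV: "finite V" using G(1) by (simp add: simple_graph_iff)
  obtain z where z: "z \<in> V" "z \<noteq> v" "z \<notin> A" using ne A(2) by blast
  have "z \<noteq> a" using z A(1) by blast
  have "card {d \<in> E. z \<in> d} \<ge> 2" using deg[OF z(1)] by (simp add: degree_def)
  then have "\<not> {d \<in> E. z \<in> d} \<subseteq> {{z, v}}" using card_mono[of "{{z, v}}" "{d \<in> E. z \<in> d}"] by auto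
  then obtain d where d: "d \<in> E" "z \<in> d" "d \<noteq> {z, v}" by blast
  obtain p q where pq: "d = {p, q}" "p \<noteq> q" "p \<in> V" "q \<in> V" using simple_graph_edgeE[OF G(1) d(1)] .
  have "\<exists>y. d = {z, y} \<and> y \<noteq> z \<and> y \<in> V" using pq d(2) by (auto simp: insert_commute)
  then obtain y where y: "d = {z, y}" "y \<noteq> z" "y \<in> V" by blast
  have "y \<noteq> v" using y d by auto
  have "{y, z} \<in> ?K" using d y z \<open>z \<noteq> a\<close> by (auto simp: insert_commute doubleton_eq_iff)
  then have "y \<notin> A" using A(3)[of y z] z by blast
  have "insert v (insert y (insert z A)) \<subseteq> V" using A(2) y z ends by blast
  then have "card (insert v (insert y (insert z A))) \<le> card V" using fV by (rule card_mono[rotated])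
  moreover have "finite A" using A(2) fV finite_subset by blast
  moreover have "v \<notin> A" using A(2) by blast
  ultimately show ?thesis using z(2,3) y(2) \<open>y \<noteq> v\<close> \<open>y \<notin> A\<close> by simp
qed

lemma core_index_delete_vertex:
  assumes "simple_graph (V, E)"
  shows "core_index (V - {v}, {e \<in> E. v \<notin> e}) + card (rooted (V, E) v) \<le> core_index (V, E)"
proof -
  let ?X = "conn_subgraphs (V - {v}, {e \<in> E. v \<notin> e})" and ?Y = "rooted (V, E) v"
  have fin: "finite (conn_subgraphs (V, E))" using finite_conn_subgraphs[OF assms] .
  have sub: "?X \<union> ?Y \<subseteq> conn_subgraphs (V, E)"
    using conn_subgraphs_mono[of "V - {v}" V "{e \<in> E. v \<notin> e}" E] by (auto simp: rooted_def)
  moreover have "?X \<inter> ?Y = {}" by (auto simp: rooted_def conn_subgraphs_def subgraph_def)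
  moreover have "finite ?X" "finite ?Y" using finite_subset[OF sub fin] by auto
  ultimately show ?thesis unfolding core_index_eq
    using card_mono[OF fin sub] card_Un_disjoint[of ?X ?Y] by linarith
qed

text \<open>Disjointness of \<open>D\<close> and \<open>D'\<close> is recorded so that edges can be
  counted: together with the bridge there are more edges than vertices.\<close>

lemma bridge_structure:
  assumes G: "connected_graph (V, E)" "simple_graph (V, E)" and va: "{v, a} \<in> E"
    and deg: "\<And>x. x \<in> V \<Longrightarrow> degree (V, E) x \<ge> 2"
    and bridge: "\<not> connected_graph (V, E - {{v, a}})"
  obtains A B D D' where "v \<in> A" "a \<in> B" "A \<union> B = V" "A \<inter> B = {}"
    "D \<subseteq> E - {{v, a}}" "D' \<subseteq> E - {{v, a}}" "D \<inter> D' = {}"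
    "connected_graph (A, D)" "simple_graph (A, D)" "card A \<le> card D"
    "connected_graph (B, D')" "simple_graph (B, D')" "card B \<le> card D'"
proof -
  let ?K = "E - {{v, a}}"
  let ?A = "reach ?K v" and ?B = "reach ?K a"
  let ?D = "{d \<in> ?K. d \<subseteq> ?A}" and ?D' = "{d \<in> ?K. d \<subseteq> ?B}"
  note sides = bridge_sides[OF G va bridge]
  have simK: "simple_graph (V, ?K)" by (rule simple_graph_mono[OF G(2)]) blast
  have self: "v \<in> ?A" "a \<in> ?B" by (rule reach_self)+
  have aA: "a \<notin> ?A" "v \<notin> ?B" using sides self by blast+
  have "?D \<inter> ?D' = {}"
  proof -
    have "d \<noteq> {}" if "d \<in> E" for d
    proof -
      have "card d = 2" using that G(2) by (simp add: simple_graph_iff)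
      then show ?thesis by auto
    qed
    then show ?thesis using sides(1) by blast
  qed
  moreover have "simple_graph (?A, ?D)" "simple_graph (?B, ?D')"
    by (rule simple_graph_induced[OF simK], use sides(2) in blast)+
  moreover have "card ?A \<le> card ?D" using bridge_side_unicyclic[OF G(2) va deg aA(1)] by blast
  moreover have "card ?B \<le> card ?D'"
    using bridge_side_unicyclic[OF G(2) _ deg, of a v] va aA(2) by (simp add: insert_commute)
  ultimately show ?thesis
    using that[of ?A ?B ?D ?D'] self sides connected_reach[of ?K v] connected_reach[of ?K a] by blast
qed

lemma unicyclic_card_ge_3:
  assumes "simple_graph (A, D)" "card A \<le> card D" "A \<noteq> {}"
  shows "card A \<ge> 3"
proof (rule ccontr)
  assume "\<not> ?thesis"
  then have "card A = 0 \<or> card A = 1 \<or> card A = 2" by linarith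
  have fA: "finite A" using assms by (simp add: simple_graph_iff)
  have "D \<subseteq> {d. d \<subseteq> A \<and> card d = 2}" using assms by (auto simp: simple_graph_iff)
  then have "card D \<le> card A choose 2" using fA card_mono[of "{d. d \<subseteq> A \<and> card d = 2}" D] by (simp add: n_subsets)
  moreover have "card A \<ge> 1" using fA assms(3) by (simp add: Suc_le_eq card_gt_0_iff)
  ultimately show False using assms(2) \<open>_ \<or> _\<close> by (auto simp: numeral_2_eq_2)
qed

section \<open>The inductions for more edges than vertices and for equally many\<close>

text \<open>Everything is doubled to stay in the natural numbers, so the house, one short of 55,
  appears as the correction 2. The measure includes the edges because one case deletes an edge and
  keeps all vertices.\<close>

theorem core_index_bicyclic:
  assumes "connected_graph (V, E)" "simple_graph (V, E)" "card V \<ge> 5" "card V < card E"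
  shows "(card V)\<^sup>2 + 17 * card V \<le> 2 * core_index (V, E) + (if card V = 5 then 2 else 0)"
  using assms
proof (induction "card V + card E" arbitrary: V E rule: less_induct)
  case less
  note G = less.prems(1,2)
  have fV: "finite V" and fE: "finite E" and EV: "E \<subseteq> Pow V"
    using G(2) simple_graph_finite_edges[OF G(2)] by (auto simp: simple_graph_iff)
  \<comment> \<open>\<open>F\<close> is the core index of a graph on one vertex less and
    \<open>N\<close> the loss. The doubled bound grows by \<open>2 * (card V + 8)\<close>; at
    \<open>card V = 6\<close> the hypothesis is one short, so \<open>N\<close> has to be one
    larger.\<close>
  have step: ?case
    if IH: "(card W)\<^sup>2 + 17 * card W \<le> 2 * F + (if card W = 5 then 2 else 0)" and W: "card W + 1 = card V"
      and F: "F + N \<le> core_index (V, E)" and N: "card V + 8 \<le> N" "card V = 6 \<Longrightarrow> card V + 9 \<le> N"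
    for W :: "'a set" and F N
  proof -
    have eq: "(card V)\<^sup>2 + 17 * card V = (card W)\<^sup>2 + 17 * card W + 2 * (card V + 8)"
      unfolding W[symmetric] by (simp add: power2_eq_square algebra_simps)
    show ?thesis
    proof (cases "card V = 6")
      case True
      then have "card W = 5" using W by simp
      then show ?thesis using IH F N eq True by simp
    next
      case False
      then have "card W \<noteq> 5" using W by simp
      then show ?thesis using IH F N eq False by simp
    qed
  qed
  show ?case
  proof (cases "card V = 5")
    case True
    \<comment> \<open>With the correction, \<open>2 * 54 + 2\<close> is exactly 25 + 85.\<close>
    then show ?thesis using core_index_5[OF G(2)] less.prems(4) by (simp add: power2_eq_square)
  next
    case n5: False
    then have n6: "card V \<ge> 6" using less.prems(3) by simp
    show ?thesis
    proof (cases "\<exists>v\<in>V. degree (V, E) v = 1")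
      case True
      then obtain v where v: "v \<in> V" "degree (V, E) v = 1" by blast
      note del = delete_pendant[OF G v]
      \<comment> \<open>At least \<open>card V\<close> nonspanning and 9 spanning subgraphs contain
        \<open>v\<close>; with only 4 spanning ones the step to six vertices would fail.\<close>
      have "card (rooted (V, E) v) \<ge> card V + 9"
        using card_rooted[OF G(2) v(1)] nonspanning_unicyclic_ge[OF G v(1)] spanning_ge_9[OF G] less.prems(4) by linarith
      moreover have "(card (V - {v}))\<^sup>2 + 17 * card (V - {v})
          \<le> 2 * core_index (V - {v}, {e \<in> E. v \<notin> e}) + (if card (V - {v}) = 5 then 2 else 0)"
        using del n6 less.prems(4) by (intro less.hyps) linarith+
      ultimately show ?thesis
        by (intro step[OF _ del(3) core_index_delete_vertex[OF G(2), of v]]) linarith+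
    next
      case no_pendant: False
      have deg: "degree (V, E) x \<ge> 2" if x: "x \<in> V" for x
      proof -
        have "degree (V, E) x \<noteq> 0" using n6 by (intro degree_nonzero[OF G x]) simp
        moreover have "degree (V, E) x \<noteq> 1" using no_pendant x by blast
        ultimately show ?thesis by linarith
      qed
      show ?thesis
      proof (cases "\<exists>v a. {v, a} \<in> E \<and> (\<forall>c. {v, c} \<in> E \<longrightarrow> {a, c} \<notin> E)")
        case True
        then obtain v a where va: "{v, a} \<in> E" and tri: "\<And>c. {v, c} \<in> E \<Longrightarrow> {a, c} \<notin> E" by blast
        let ?K = "E - {{v, a}}"
        let ?N = "{H \<in> conn_subgraphs (V, ?K). v \<in> fst H \<or> a \<in> fst H}"
        have ends: "v \<noteq> a" "v \<in> V" "a \<in> V" using simple_graph_noteq[OF G(2) va] by auto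
        have simK: "simple_graph (V, ?K)" by (rule simple_graph_mono[OF G(2)]) blast
        have cK: "card ?K + 1 = card E" using va fE card_Suc_Diff1[of E "{v, a}"] by simp
        note con = connected_contract[OF G(2) va G(1)] and sim = simple_contract[OF G(2) va]
          and cc = card_contract[OF G(2) va tri]
        have IH: "(card (V - {a}))\<^sup>2 + 17 * card (V - {a})
          \<le> 2 * core_index (V - {a}, contract_edges E v a) + (if card (V - {a}) = 5 then 2 else 0)"
          using cc n6 less.prems(4) by (intro less.hyps con sim) linarith+
        note contr = step[OF IH cc(2) core_index_contract[OF G(2) va]]
        show ?thesis
        proof (cases "connected_graph (V, ?K)")
          case conK: True
          have sym: "{H \<in> conn_subgraphs (V, ?K). a \<in> fst H \<or> v \<in> fst H} = ?N" by blast
          let ?A = "reach {d \<in> ?K. v \<notin> d} a" and ?B = "reach {d \<in> ?K. a \<notin> d} v"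
          have N1: "card V + 4 + card ?A \<le> card ?N"
            using less.prems(4) cK by (intro card_roots_ge[OF conK simK ends(2,3,1)]) linarith
          have N2: "card V + 4 + card ?B \<le> card ?N"
            using card_roots_ge[OF conK simK ends(3,2) ends(1)[symmetric]] less.prems(4) cK unfolding sym by linarith
          have AB: "card V < card ?A + card ?B"
            by (rule avoiding_reach_sides[OF conK simK ends(2,3,1)]) blast
          show ?thesis
          proof (cases "card V = 6")
            case True
            \<comment> \<open>Otherwise both components have at most three of the six vertices,
              although their orders add up to more than 6. A component of order 5 gives the required
              loss 6 + 4 + 5.\<close>
            have "?A = V - {v} \<or> ?B = V - {a}"
            proof (rule ccontr)
              assume n: "\<not> ?thesis"
              have "card ?A + 3 \<le> card V" using avoiding_reach_small[OF G(2) va deg] n by blast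
              moreover have "card ?B + 3 \<le> card V"
                using avoiding_reach_small[OF G(2) _ deg, of a v] n va by (simp add: insert_commute)
              ultimately show False using AB True by linarith
            qed
            moreover have c5: "card (V - {v}) = 5" "card (V - {a}) = 5" using True ends fV by simp_all
            ultimately have "card ?A = 5 \<or> card ?B = 5" by (elim disjE) (simp_all only: c5 simp_thms)
            then have "card V + 9 \<le> card ?N" using N1 N2 by (elim disjE) linarith+
            then show ?thesis by (intro contr) linarith+
          next
            case False
            \<comment> \<open>The two orders add up to more than 6, so one of them is at least 4 and
              provides the second 4 of the loss.\<close>
            then have "card ?A \<ge> 4 \<or> card ?B \<ge> 4" using AB n6 by linarith
            then have "card V + 8 \<le> card ?N" using N1 N2 by (elim disjE) linarith+
            then show ?thesis using False by (intro contr) linarith+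
          qed
        next
          case bridge: False
          obtain A B D D' where AB: "v \<in> A" "a \<in> B" "A \<union> B = V" "A \<inter> B = {}"
            "D \<subseteq> ?K" "D' \<subseteq> ?K" "D \<inter> D' = {}"
            "connected_graph (A, D)" "simple_graph (A, D)" "card A \<le> card D"
            "connected_graph (B, D')" "simple_graph (B, D')" "card B \<le> card D'"
            using bridge_structure[OF G va deg bridge] by blast
          have fAB: "finite A" "finite B" using AB(3) fV by auto
          have cAB: "card A + card B = card V" using card_Un_disjoint[OF fAB AB(4)] AB(3) by simp
          have RA: "card (rooted (A, D) v) \<ge> card A + 4" by (rule rooted_unicyclic_ge[OF AB(8,9,1,10)])
          have RB: "card (rooted (B, D') a) \<ge> card B + 4" by (rule rooted_unicyclic_ge[OF AB(11,12,2,13)])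
          have sub: "A \<subseteq> V" "B \<subseteq> V" "v \<notin> B" "D \<subseteq> E" "D' \<subseteq> E" using AB by auto
          show ?thesis
          proof (cases "card V = 6")
            case True
            \<comment> \<open>Both sides are triangles, with at least 7 subgraphs through a given
              vertex, and 10 + 10 + 7 * 7 = 69 meets the bound exactly.\<close>
            have "card A \<ge> 3" "card B \<ge> 3" using unicyclic_card_ge_3 AB by blast+
            then have c3: "card A = 3" "card B = 3" using cAB True by auto
            have "D \<subseteq> Pow A" "D' \<subseteq> Pow B" using AB by (auto simp: simple_graph_iff)
            then have "core_index (V, E) \<ge> core_index (A, D) + core_index (B, D')
              + card (rooted (A, D) v) * card (rooted (B, D') a)"
              using AB sub by (intro core_index_bridge[OF G(2) va]) auto
            moreover have "core_index (A, D) \<ge> 10" "core_index (B, D') \<ge> 10"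
              using core_index_3[OF AB(9)] core_index_3[OF AB(12)] AB(10,13) c3 by auto
            moreover have "card (rooted (A, D) v) * card (rooted (B, D') a) \<ge> 7 * 7"
              using RA RB c3 by (intro mult_le_mono) auto
            ultimately show ?thesis using True by (simp add: power2_eq_square)
          next
            case False
            have "card (rooted (A, D) v) + card (rooted (B, D') a) \<le> card ?N"
              by (rule card_two_roots[OF simK sub(1) AB(5) sub(2) AB(6) sub(3)])
            then have "card V + 8 \<le> card ?N" using RA RB cAB by linarith
            then show ?thesis using False by (intro contr) linarith+
          qed
        qed
      next
        case all_tri: False
        then have tri: "\<exists>c. {u, c} \<in> E \<and> {w, c} \<in> E" if "{u, w} \<in> E" for u w using that by blast
        have cE: "3 * card V \<le> 2 * card E + 3" by (rule edges_in_triangles[OF G tri])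
        have "E \<noteq> {}" using less.prems(4) by auto
        then obtain e where e: "e \<in> E" by blast
        obtain v a where va: "e = {v, a}" "v \<noteq> a" "v \<in> V" "a \<in> V" using simple_graph_edgeE[OF G(2) e] .
        obtain c where c: "{v, c} \<in> E" "{a, c} \<in> E" using tri[of v a] e va by blast
        have cv: "c \<noteq> v" "c \<noteq> a" using c simple_graph_noteq[OF G(2)] by blast+
        let ?K = "E - {e}"
        have conK: "connected_graph (V, ?K)"
        proof (rule connected_graphI)
          show "V \<noteq> {}" using va by blast
        next
          fix S assume S: "S \<subseteq> V" "S \<noteq> {}" "S \<noteq> V"
          obtain p q where pq: "p \<in> V" "q \<in> V" "p \<in> S" "q \<notin> S" using S by blast
          obtain x y where xy: "{x, y} \<in> E" "x \<in> V" "y \<in> V" "x \<in> S" "y \<notin> S"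
            by (rule connected_cut[OF G(1) EV pq])
          \<comment> \<open>The edge \<open>e\<close> can be replaced by the detour over
            \<open>c\<close>: on whichever side \<open>c\<close> lies, one of the two other triangle
            edges crosses.\<close>
          have c': "{v, c} \<in> ?K" "{a, c} \<in> ?K" "{c, v} \<in> ?K" "{c, a} \<in> ?K"
            using c cv va by (auto simp: doubleton_eq_iff insert_commute)
          have "c \<in> V" using c EV by auto
          show "\<exists>u\<in>S. \<exists>w\<in>V - S. {u, w} \<in> ?K"
          proof (cases "{x, y} = e")
            case False
            then show ?thesis using xy by blast
          next
            case True
            then have "(x = v \<and> y = a) \<or> (x = a \<and> y = v)" using va by (auto simp: doubleton_eq_iff)
            then show ?thesis using c' xy \<open>c \<in> V\<close> by (cases "c \<in> S") blast+
          qed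
        qed
        have cK: "card ?K + 1 = card E" using e fE card_Suc_Diff1[of E e] by simp
        \<comment> \<open>After the deletion twice the number of edges is still at least 3n - 5,
          which exceeds 2n because n is at least 6. The vertex number is unchanged, so the bound
          carries over as it stands.\<close>
        have "(card V)\<^sup>2 + 17 * card V \<le> 2 * core_index (V, ?K) + (if card V = 5 then 2 else 0)"
          using cK cE n6 conK simple_graph_mono[OF G(2), of ?K] by (intro less.hyps) auto
        moreover have "core_index (V, ?K) \<le> core_index (V, E)" by (rule core_index_mono[OF G(2)]) blast
        ultimately show ?thesis using n5 by simp
      qed
    qed
  qed
qed

text \<open>The increment 2n - 1 is n + (n - 1): after removal of the edge \<open>{v, a}\<close>, n
  connected subgraphs contain \<open>v\<close>, and n - 1 contain \<open>a\<close> and avoid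
  \<open>v\<close>. Contraction keeps all degrees at least 2.\<close>

theorem core_index_two_regular:
  assumes "connected_graph (V, E)" "simple_graph (V, E)" "card V \<ge> 3" "card E = card V"
    "\<And>x. x \<in> V \<Longrightarrow> degree (V, E) x \<ge> 2"
  shows "(card V)\<^sup>2 + 1 \<le> core_index (V, E)"
  using assms
proof (induction "card V" arbitrary: V E rule: less_induct)
  case less
  note G = less.prems(1,2)
  note deg = less.prems(5)
  have fV: "finite V" and fE: "finite E" and EV: "E \<subseteq> Pow V"
    using G(2) simple_graph_finite_edges[OF G(2)] by (auto simp: simple_graph_iff)
  show ?case
  proof (cases "card V = 3")
    case True
    then show ?thesis using core_index_3[OF G(2)] less.prems(4) by simp
  next
    case False
    then have n4: "card V \<ge> 4" using less.prems(3) by simp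
    \<comment> \<open>If every edge lay in a triangle, 3n would be at most 2n + 3.\<close>
    have "\<exists>v a. {v, a} \<in> E \<and> (\<forall>c. {v, c} \<in> E \<longrightarrow> {a, c} \<notin> E)"
    proof (rule ccontr)
      assume "\<not> ?thesis"
      then have "\<exists>c. {u, c} \<in> E \<and> {w, c} \<in> E" if "{u, w} \<in> E" for u w using that by blast
      then have "3 * card V \<le> 2 * card E + 3" using edges_in_triangles[OF G] by blast
      then show False using n4 less.prems(4) by linarith
    qed
    then obtain v a where va: "{v, a} \<in> E" and tri: "\<And>c. {v, c} \<in> E \<Longrightarrow> {a, c} \<notin> E" by blast
    let ?K = "E - {{v, a}}"
    let ?N = "{H \<in> conn_subgraphs (V, ?K). v \<in> fst H \<or> a \<in> fst H}"
    have ends: "v \<noteq> a" "v \<in> V" "a \<in> V" using simple_graph_noteq[OF G(2) va] by auto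
    have simK: "simple_graph (V, ?K)" by (rule simple_graph_mono[OF G(2)]) blast
    have cK: "card ?K + 1 = card E" using va fE card_Suc_Diff1[of E "{v, a}"] by simp
    note con = connected_contract[OF G(2) va G(1)] and sim = simple_contract[OF G(2) va]
      and cc = card_contract[OF G(2) va tri]
    have IH: "(card (V - {a}))\<^sup>2 + 1 \<le> core_index (V - {a}, contract_edges E v a)"
      using cc n4 less.prems(4) degree_contract[OF G(2) va tri deg] by (intro less.hyps con sim) simp_all
    \<comment> \<open>A bridge would leave two sides with at least as many edges as vertices each,
      so with the bridge there would be more edges than vertices.\<close>
    have conK: "connected_graph (V, ?K)"
    proof (rule ccontr)
      assume bridge: "\<not> ?thesis"
      obtain A B D D' where "v \<in> A" "a \<in> B" and AB: "A \<union> B = V" "A \<inter> B = {}"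
        "D \<subseteq> ?K" "D' \<subseteq> ?K" "D \<inter> D' = {}"
        and "connected_graph (A, D)" "simple_graph (A, D)" and cA: "card A \<le> card D"
        and "connected_graph (B, D')" "simple_graph (B, D')" and cB: "card B \<le> card D'"
        using bridge_structure[OF G va deg bridge] by blast
      have "card V = card A + card B" using card_Un_disjoint[of A B] AB(1,2) fV by auto
      moreover have "finite D" "finite D'" using AB(3,4) fE by (meson finite_Diff finite_subset)+
      then have "card (D \<union> D') = card D + card D'" using AB(5) by (rule card_Un_disjoint)
      moreover have "card (D \<union> D') \<le> card ?K" using AB(3,4) fE by (intro card_mono) simp_all
      ultimately show False using cA cB cK less.prems(4) by linarith
    qed
    \<comment> \<open>The degree sum is \<open>2 * card V\<close>, so no degree can exceed 2; hence
      \<open>v\<close> becomes pendant without the edge to \<open>a\<close>, and removing it keeps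
      the rest connected.\<close>
    have "degree (V, E) v = 2"
    proof (rule ccontr)
      assume "degree (V, E) v \<noteq> 2"
      then have v3: "degree (V, E) v > 2" using deg[OF ends(2)] by simp
      have "(\<Sum>x\<in>V. 2) < (\<Sum>x\<in>V. degree (V, E) x)"
        using v3 ends(2) deg by (intro sum_strict_mono_ex1[OF fV]) auto
      then show False using handshake[OF G(2)] less.prems(4) by simp
    qed
    moreover have "{d \<in> ?K. v \<in> d} = {d \<in> E. v \<in> d} - {{v, a}}" by blast
    ultimately have "degree (V, ?K) v = 1"
      using va fE by (simp add: degree_def)
    note del = delete_pendant[OF conK simK ends(2) this]
    have "card (rooted (V, ?K) v) + card (rooted (V - {v}, {d \<in> ?K. v \<notin> d}) a) \<le> card ?N"
      by (rule card_two_roots[OF simK]) auto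
    moreover have "card (rooted (V, ?K) v) \<ge> card V" by (rule rooted_ge[OF conK simK ends(2)])
    moreover have "card (rooted (V - {v}, {d \<in> ?K. v \<notin> d}) a) \<ge> card (V - {v})"
      using ends by (intro rooted_ge[OF del(1,2)]) auto
    ultimately have "card V + card (V - {v}) \<le> card ?N" by linarith
    then have "(card (V - {a}))\<^sup>2 + 1 + (card V + card (V - {v})) \<le> core_index (V, E)"
      using core_index_contract[OF G(2) va] IH by linarith
    moreover have "card (V - {v}) = card (V - {a})" using del(3) cc(2) by simp
    moreover have "(card V)\<^sup>2 = (card (V - {a}))\<^sup>2 + (card V + card (V - {a}))"
    proof -
      define k where "k = card (V - {a})"
      have "card V = k + 1" using cc(2) by (simp add: k_def)
      then show ?thesis unfolding k_def[symmetric] by (simp add: power2_eq_square)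
    qed
    ultimately show ?thesis by simp
  qed
qed

section \<open>Upper bounds\<close>

lemma conn_subgraphs_cut:
  assumes H: "(W, D) \<in> conn_subgraphs G" and xy: "x \<in> W" "y \<in> W" "x \<in> S" "y \<notin> S"
  obtains u w where "{u, w} \<in> D" "{u, w} \<in> snd G" "u \<in> W" "w \<in> W" "u \<in> S" "w \<notin> S"
proof -
  have s: "connected_graph (W, D)" "D \<subseteq> Pow W" "D \<subseteq> snd G"
    using H by (auto simp: conn_subgraphs_def subgraph_def)
  obtain u w where "{u, w} \<in> D" "u \<in> W" "w \<in> W" "u \<in> S" "w \<notin> S"
    by (rule connected_cut[OF s(1,2) xy])
  then show ?thesis using that s(3) by blast
qed

section \<open>Connected subgraphs of a cycle\<close>

text \<open>The path on \<open>k\<close> vertices that starts right after \<open>i\<close>. For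
  \<open>k = n\<close> it is spanning and lacks only the edge from \<open>i\<close> to its
  successor.\<close>

definition cycle_arc :: "nat \<Rightarrow> nat \<Rightarrow> nat \<Rightarrow> nat ugraph" where
  "cycle_arc n i k = ((\<lambda>j. (i + 1 + j) mod n) ` {..<k},
     (\<lambda>j. {(i + 1 + j) mod n, (i + 1 + Suc j) mod n}) ` {j. Suc j < k})"

text \<open>The successor of \<open>i\<close> is in the subgraph but the edge leading to it is not,
  so it is the first vertex of an arc. The map \<open>p\<close> numbers the cycle from there; the
  missing edge is the one closing the numbering, and only subgraphs of a path remain.\<close>

lemma cycle_conn_subgraph_arc:
  assumes n: "n \<ge> 3" and H: "(W, D) \<in> conn_subgraphs (cycle_graph n)"
    and i: "i < n" "(i + 1) mod n \<in> W" "{i, (i + 1) mod n} \<notin> D"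
  shows "\<exists>k\<in>{1..n}. (W, D) = cycle_arc n i k"
proof -
  define p where "p j = (i + 1 + j) mod n" for j
  have WD: "W \<subseteq> {..<n}" "D \<subseteq> snd (cycle_graph n)" "D \<subseteq> Pow W"
    using H by (auto simp: conn_subgraphs_def subgraph_def cycle_graph_def)
  have p: "p j = (if i + 1 + j < n then i + 1 + j else i + 1 + j - n)" if "j < n" for j
    using that i(1) by (auto simp: p_def mod_if)
  have inj: "j = j'" if "p j = p j'" "j < n" "j' < n" for j j'
    using that p[of j] p[of j'] by (auto split: if_splits)
  have surj: "\<exists>j<n. p j = x" if "x < n" for x
  proof (cases "i < x")
    case True
    then show ?thesis using that p[of "x - i - 1"] by (intro exI[of _ "x - i - 1"]) auto
  next
    case False
    then show ?thesis using i(1) p[of "x + n - i - 1"] by (intro exI[of _ "x + n - i - 1"]) auto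
  qed
  have edge: "\<exists>j. Suc j < n \<and> d = {p j, p (Suc j)}" if d: "d \<in> D" for d
  proof -
    obtain x where x: "x < n" "d = {x, (x + 1) mod n}" using subsetD[OF WD(2) d] by (auto simp: cycle_graph_def)
    obtain j where j: "j < n" "p j = x" using surj[OF x(1)] by blast
    have "x \<noteq> i" using x d i(3) by auto
    \<comment> \<open>\<open>p (n - 1)\<close> is \<open>i\<close>, so \<open>Suc j = n\<close>
      would belong to the missing edge.\<close>
    then have "Suc j \<noteq> n" using j p[of j] i(1) by (auto split: if_splits)
    moreover have "(x + 1) mod n = p (Suc j)" unfolding j(2)[symmetric] by (simp add: p_def mod_Suc_eq)
    ultimately show ?thesis using j x by (intro exI[of _ j]) auto
  qed
  have p0: "p 0 \<in> W" using i(2) by (simp add: p_def)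
  \<comment> \<open>Of the edges left, only the one from \<open>p t\<close> to
    \<open>p (Suc t)\<close> leaves the initial segment up to \<open>t\<close>; reaching
    \<open>p j\<close> from \<open>p 0\<close> requires it.\<close>
  have path: "{p t, p (Suc t)} \<in> D" if j: "p j \<in> W" "j < n" "t < j" for j t
  proof -
    have "p s \<noteq> p j" if "s \<le> t" for s using inj[of s j] that j by auto
    then have S: "p 0 \<in> p ` {..t}" "p j \<notin> p ` {..t}" by (simp, metis atMost_iff imageE)
    obtain u w where uw: "{u, w} \<in> D" "u \<in> p ` {..t}" "w \<notin> p ` {..t}"
      by (rule conn_subgraphs_cut[OF H p0 j(1) S])
    obtain s where s: "Suc s < n" "{u, w} = {p s, p (Suc s)}" using edge[OF uw(1)] by blast
    consider "u = p s" "w = p (Suc s)" | "u = p (Suc s)" "w = p s" using s(2) by (auto simp: doubleton_eq_iff)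
    then have "s = t"
    proof cases
      case 1
      obtain s' where s': "s' \<le> t" "u = p s'" using uw(2) by auto
      have "s' = s" using inj[of s' s] s' 1 s j by simp
      moreover have "\<not> Suc s \<le> t" using uw(3) 1 by auto
      ultimately show ?thesis using s' by simp
    next
      case 2
      obtain s' where s': "s' \<le> t" "u = p s'" using uw(2) by auto
      have "s' = Suc s" using inj[of s' "Suc s"] s' 2 s j by simp
      moreover have "\<not> s \<le> t" using uw(3) 2 by auto
      ultimately show ?thesis using s' by simp
    qed
    then show ?thesis using uw(1) s(2) by simp
  qed
  define J where "J = {j. j < n \<and> p j \<in> W}"
  have fJ: "finite J" "0 \<in> J" using p0 n by (auto simp: J_def)
  define k where "k = Suc (Max J)"
  have kJ: "Max J \<in> J" using Max_in[OF fJ(1)] fJ(2) by blast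
  have J: "J = {..<k}"
  proof (intro set_eqI iffI)
    fix j assume "j \<in> J"
    then show "j \<in> {..<k}" using Max_ge[OF fJ(1)] by (simp add: k_def le_imp_less_Suc)
  next
    fix j assume "j \<in> {..<k}"
    then have "j = Max J \<or> j < Max J" by (auto simp: k_def)
    then show "j \<in> J"
    proof
      assume j: "j < Max J"
      have "{p j, p (Suc j)} \<in> D" using path[of "Max J" j] kJ j by (simp add: J_def)
      then show ?thesis using WD(3) j kJ by (auto simp: J_def)
    qed (use kJ in simp)
  qed
  have "W = p ` {..<k}"
  proof
    show "W \<subseteq> p ` {..<k}" unfolding J[symmetric]
    proof
      fix x assume "x \<in> W"
      then obtain j where "j < n" "p j = x" using surj[of x] WD(1) by blast
      then show "x \<in> p ` J" using \<open>x \<in> W\<close> by (auto simp: J_def)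
    qed
    show "p ` {..<k} \<subseteq> W" unfolding J[symmetric] by (auto simp: J_def)
  qed
  moreover have "D = (\<lambda>j. {p j, p (Suc j)}) ` {j. Suc j < k}"
  proof
    show "D \<subseteq> (\<lambda>j. {p j, p (Suc j)}) ` {j. Suc j < k}"
    proof
      fix d assume d: "d \<in> D"
      obtain j where j: "Suc j < n" "d = {p j, p (Suc j)}" using edge[OF d] by blast
      then have "Suc j \<in> J" using WD(3) d by (auto simp: J_def)
      then show "d \<in> (\<lambda>j. {p j, p (Suc j)}) ` {j. Suc j < k}" using J j by auto
    qed
    show "(\<lambda>j. {p j, p (Suc j)}) ` {j. Suc j < k} \<subseteq> D"
      using path[of "Max J"] kJ by (auto simp: J_def k_def)
  qed
  moreover have "k \<in> {1..n}" using kJ by (auto simp: k_def J_def)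
  ultimately show ?thesis unfolding cycle_arc_def p_def by blast
qed

text \<open>Every vertex of the subgraph brings in the edge from its predecessor and thus the
  predecessor; going backwards round the cycle collects everything.\<close>

lemma cycle_conn_subgraph_full:
  assumes n: "n \<ge> 3" and H: "(W, D) \<in> conn_subgraphs (cycle_graph n)"
    and i: "\<And>i. i < n \<Longrightarrow> (i + 1) mod n \<in> W \<Longrightarrow> {i, (i + 1) mod n} \<in> D"
  shows "(W, D) = cycle_graph n"
proof -
  have WD: "W \<subseteq> {..<n}" "D \<subseteq> snd (cycle_graph n)" "D \<subseteq> Pow W" "W \<noteq> {}"
    using H by (auto simp: conn_subgraphs_def subgraph_def cycle_graph_def connected_graph_def)
  obtain x where x: "x \<in> W" using WD(4) by blast
  have pred: "y \<in> W" if "y < n" "(y + t) mod n = x" for y t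
    using that
  proof (induction t arbitrary: y)
    case 0
    then show ?case using x by simp
  next
    case (Suc t)
    have "((y + 1) mod n + t) mod n = x" using Suc.prems by (simp add: mod_simps)
    then have "(y + 1) mod n \<in> W" using Suc.IH[of "(y + 1) mod n"] n by simp
    then show ?case using i[OF Suc.prems(1)] WD(3) by auto
  qed
  \<comment> \<open>Going \<open>x + n - y\<close> steps forward from \<open>y\<close> ends at
    \<open>x\<close> modulo \<open>n\<close>; adding \<open>n\<close> keeps the difference
    nonnegative.\<close>
  have "y \<in> W" if "y < n" for y
    using pred[OF that, of "x + n - y"] that x WD(1) by auto
  then have W: "W = {..<n}" using WD(1) by auto
  have "snd (cycle_graph n) \<subseteq> D" using i W n by (auto simp: cycle_graph_def)
  then show ?thesis using W WD(2) by (auto simp: cycle_graph_def)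
qed

text \<open>There are \<open>n\<close> possible starts and \<open>n\<close> possible lengths of an
  arc; the remaining subgraph is the whole cycle.\<close>

lemma core_index_cycle_le:
  assumes n: "n \<ge> 3"
  shows "core_index (cycle_graph n) \<le> n\<^sup>2 + 1"
proof -
  let ?A = "(\<lambda>(i, k). cycle_arc n i k) ` ({..<n} \<times> {1..n})"
  have "conn_subgraphs (cycle_graph n) \<subseteq> insert (cycle_graph n) ?A"
  proof
    fix H assume H: "H \<in> conn_subgraphs (cycle_graph n)"
    obtain W D where WD: "H = (W, D)" by (cases H)
    show "H \<in> insert (cycle_graph n) ?A"
    proof (cases "\<exists>i<n. (i + 1) mod n \<in> W \<and> {i, (i + 1) mod n} \<notin> D")
      case True
      then obtain i where i: "i < n" "(i + 1) mod n \<in> W" "{i, (i + 1) mod n} \<notin> D" by blast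
      then obtain k where "k \<in> {1..n}" "H = cycle_arc n i k"
        using cycle_conn_subgraph_arc[OF n H[unfolded WD]] WD by blast
      then show ?thesis using i(1) by auto
    next
      case False
      then have "H = cycle_graph n" using cycle_conn_subgraph_full[OF n H[unfolded WD]] WD by blast
      then show ?thesis by blast
    qed
  qed
  then have "core_index (cycle_graph n) \<le> card (insert (cycle_graph n) ?A)"
    unfolding core_index_eq by (intro card_mono) auto
  also have "\<dots> \<le> Suc (card ?A)" by (rule card_insert_le_m1) simp_all
  also have "card ?A \<le> card ({..<n} \<times> {1..n})" by (rule card_image_le) simp
  also have "\<dots> = n\<^sup>2" by (simp add: power2_eq_square)
  finally show ?thesis by simp
qed

section \<open>Two triangles joined by a path\<close>

text \<open>Describes one end of \<open>two_triangle_graph\<close>: a triangle attached to the rest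
  only at its apex \<open>r\<close>. It is instantiated once for each end.\<close>

locale hanging_triangle =
  fixes V :: "'a set" and E :: "'a set set" and r x y :: 'a
  assumes distinct: "r \<noteq> x" "r \<noteq> y" "x \<noteq> y" and nonempty: "{} \<notin> E"
    and only: "\<And>e. e \<in> E \<Longrightarrow> e \<inter> {x, y} \<noteq> {} \<Longrightarrow> e \<in> {{r, x}, {r, y}, {x, y}}"
begin

lemma apex_in:
  assumes H: "(W, D) \<in> conn_subgraphs (V, E)" and "w \<in> W" "w \<in> {x, y}" "z \<in> W" "z \<notin> {x, y}"
  shows "r \<in> W"
proof -
  obtain u q where uq: "{u, q} \<in> D" "{u, q} \<in> snd (V, E)" "u \<in> W" "q \<in> W" "u \<in> {x, y}" "q \<notin> {x, y}"
    by (rule conn_subgraphs_cut[OF assms(1,2,4,3,5)])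
  have "{u, q} \<in> {{r, x}, {r, y}, {x, y}}" using uq by (intro only) auto
  then have "q = r" using uq(5,6) by (auto simp: doubleton_eq_iff)
  then show ?thesis using uq(4) by simp
qed

lemma off_apex:
  assumes H: "(W, D) \<in> conn_subgraphs (V, E)" and W: "W \<subseteq> {x, y}"
  shows "(W, D) \<in> {({x}, {}), ({y}, {}), ({x, y}, {{x, y}})}"
proof -
  have WD: "D \<subseteq> E" "D \<subseteq> Pow W" "W \<noteq> {}"
    using H by (auto simp: conn_subgraphs_def subgraph_def connected_graph_def)
  have D: "D \<subseteq> {{x, y}}"
  proof
    fix d assume d: "d \<in> D"
    then have "d \<noteq> {}" using nonempty WD(1) by blast
    moreover have "d \<subseteq> {x, y}" using d WD(2) W by blast
    ultimately have "d \<in> {{r, x}, {r, y}, {x, y}}" using WD(1) d by (intro only) auto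
    then show "d \<in> {{x, y}}" using \<open>d \<subseteq> {x, y}\<close> distinct by auto
  qed
  have "W = {x} \<or> W = {y} \<or> W = {x, y}" using W WD(3) by blast
  then consider "W = {x}" | "W = {y}" | "W = {x, y}" by blast
  then show ?thesis
  proof cases
    case 1
    then have "D = {}" using D WD(2) distinct by auto
    then show ?thesis using 1 by simp
  next
    case 2
    then have "D = {}" using D WD(2) distinct by auto
    then show ?thesis using 2 by simp
  next
    case 3
    have "D \<noteq> {}"
      by (rule conn_subgraphs_cut[OF H, of x y "{x}"]) (use 3 distinct in auto)
    then show ?thesis using 3 D by auto
  qed
qed

text \<open>With \<open>r\<close> present, each of \<open>x\<close>, \<open>y\<close> in
  \<open>W\<close> must be covered by a triangle edge, so the set \<open>X\<close> of triangle edges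
  determines the triangle part. Of the eight sets only the one consisting of \<open>{x, y}\<close>
  is excluded, since it leaves both vertices cut off from \<open>r\<close>.\<close>

lemma at_apex:
  assumes H: "(W, D) \<in> conn_subgraphs (V, E)" and r: "r \<in> W"
  defines "X \<equiv> D \<inter> {{r, x}, {r, y}, {x, y}}"
  shows "W \<inter> {x, y} \<subseteq> \<Union>X" "\<Union>X \<subseteq> W" "X \<in> Pow {{r, x}, {r, y}, {x, y}} - {{{x, y}}}"
proof -
  have WD: "D \<subseteq> E" "D \<subseteq> Pow W" using H by (auto simp: conn_subgraphs_def subgraph_def)
  show "\<Union>X \<subseteq> W" using WD(2) by (auto simp: X_def)
  show "W \<inter> {x, y} \<subseteq> \<Union>X"
  proof
    fix w assume w: "w \<in> W \<inter> {x, y}"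
    obtain u q where uq: "{u, q} \<in> D" "{u, q} \<in> snd (V, E)" "u \<in> {w}"
      by (rule conn_subgraphs_cut[OF H, of w r "{w}"]) (use w r distinct in auto)
    have "{u, q} \<in> {{r, x}, {r, y}, {x, y}}" using uq w by (intro only) auto
    then show "w \<in> \<Union>X" using uq by (auto simp: X_def)
  qed
  have "X \<noteq> {{x, y}}"
  proof
    assume X: "X = {{x, y}}"
    then have "x \<in> W" using WD(2) unfolding X_def by blast
    \<comment> \<open>Some edge of \<open>D\<close> has to leave \<open>{x, y}\<close> in order to
      reach \<open>r\<close>, and it can only end at \<open>r\<close>.\<close>
    obtain u q where uq: "{u, q} \<in> D" "{u, q} \<in> snd (V, E)" "u \<in> {x, y}" "q \<notin> {x, y}"
      by (rule conn_subgraphs_cut[OF H, of x r "{x, y}"]) (use \<open>x \<in> W\<close> r distinct in auto)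
    have "{u, q} \<in> {{r, x}, {r, y}, {x, y}}" using uq by (intro only) auto
    then have "{u, q} \<in> X" using uq(1) by (simp add: X_def)
    then show False using X uq by auto
  qed
  then show "X \<in> Pow {{r, x}, {r, y}, {x, y}} - {{{x, y}}}" by (auto simp: X_def)
qed

end

lemma card_triangle_edge_sets:
  assumes "r \<noteq> x" "r \<noteq> y" "x \<noteq> y"
  shows "card (Pow {{r, x}, {r, y}, {x, y}} - {{{x, y}}}) = 7"
proof -
  have "card {{r, x}, {r, y}, {x, y}} = 3" using assms by (auto simp: doubleton_eq_iff)
  then have "card (Pow {{r, x}, {r, y}, {x, y}}) = 8" by (simp add: card_Pow)
  then show ?thesis by (subst card_Diff_singleton) auto
qed

definition triangle_path :: "nat \<Rightarrow> nat \<Rightarrow> nat set set \<Rightarrow> nat set set \<Rightarrow> nat ugraph" where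
  "triangle_path i j X Y = ({i..j} \<union> \<Union>X \<union> \<Union>Y, {{t, Suc t} |t. i \<le> t \<and> t < j} \<union> X \<union> Y)"

text \<open>Here \<open>m\<close> counts the path vertices. A subgraph either misses the path and
  lies in one triangle without its apex, or meets the path in an interval from \<open>i\<close> to
  \<open>j\<close>. The left triangle can be used only if \<open>i = 0\<close>, the right one only
  if \<open>j = m - 1\<close>; this gives four families, with seven choices for each accessible
  triangle.\<close>

lemma two_triangle_conn_subgraphs:
  fixes m :: nat
  assumes m: "m \<ge> 2"
  defines "QL \<equiv> Pow {{0, m}, {0, m + 1}, {m, m + 1}} - {{{m, m + 1}}}"
    and "QR \<equiv> Pow {{m - 1, m + 2}, {m - 1, m + 3}, {m + 2, m + 3}} - {{{m + 2, m + 3}}}"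
  shows "conn_subgraphs (two_triangle_graph (m + 4)) \<subseteq>
    {({m}, {}), ({m + 1}, {}), ({m, m + 1}, {{m, m + 1}})}
    \<union> {({m + 2}, {}), ({m + 3}, {}), ({m + 2, m + 3}, {{m + 2, m + 3}})}
    \<union> (\<lambda>(X, Y). triangle_path 0 (m - 1) X Y) ` (QL \<times> QR)
    \<union> (\<lambda>(j, X). triangle_path 0 j X {}) ` ({..<m - 1} \<times> QL)
    \<union> (\<lambda>(i, Y). triangle_path i (m - 1) {} Y) ` ({1..<m} \<times> QR)
    \<union> (\<lambda>(j, i). triangle_path i j {} {}) ` (SIGMA j:{..<m - 1}. {1..j})" (is "_ \<subseteq> ?cover")
proof
  define PE where "PE = {{i, Suc i} |i. Suc i < m}"
  define LE where "LE = {{0, m}, {0, m + 1}, {m, m + 1}}"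
  define RE where "RE = {{m - 1, m + 2}, {m - 1, m + 3}, {m + 2, m + 3}}"
  define E where "E = PE \<union> LE \<union> RE"
  have G: "two_triangle_graph (m + 4) = ({..<m + 4}, E)"
    using m by (simp add: two_triangle_graph_def E_def PE_def LE_def RE_def numeral_eq_Suc)
  have PE: "z < m" if "e \<in> PE" "z \<in> e" for e z using that by (auto simp: PE_def)
  have LE: "e \<inter> {m + 2, m + 3} = {}" if "e \<in> LE" for e
  proof -
    have "e \<subseteq> {0, m, m + 1}" using that unfolding LE_def by blast
    then show ?thesis by auto
  qed
  have RE: "e \<inter> {m, m + 1} = {}" if "e \<in> RE" for e
  proof -
    have "e \<subseteq> {m - 1, m + 2, m + 3}" using that unfolding RE_def by blast
    then show ?thesis using m by auto
  qed
  have ne: "{} \<notin> E" by (auto simp: E_def PE_def LE_def RE_def)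
  have onlyL: "e \<in> {{0, m}, {0, m + 1}, {m, m + 1}}" if e: "e \<in> E" "e \<inter> {m, m + 1} \<noteq> {}" for e
  proof -
    have "e \<notin> PE" using PE[of e] e(2) by fastforce
    moreover have "e \<notin> RE" using RE[of e] e(2) by blast
    ultimately show ?thesis using e(1) by (simp add: E_def LE_def)
  qed
  have onlyR: "e \<in> {{m - 1, m + 2}, {m - 1, m + 3}, {m + 2, m + 3}}" if e: "e \<in> E" "e \<inter> {m + 2, m + 3} \<noteq> {}" for e
  proof -
    have "e \<notin> PE" using PE[of e] e(2) by fastforce
    moreover have "e \<notin> LE" using LE[of e] e(2) by blast
    ultimately show ?thesis using e(1) by (simp add: E_def RE_def)
  qed
  interpret L: hanging_triangle "{..<m + 4}" E 0 m "m + 1"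
    by (unfold_locales; (rule ne | rule onlyL | use m in simp))
  interpret R: hanging_triangle "{..<m + 4}" E "m - 1" "m + 2" "m + 3"
    by (unfold_locales; (rule ne | rule onlyR | use m in simp))
  fix H assume "H \<in> conn_subgraphs (two_triangle_graph (m + 4))"
  moreover obtain W D where WD: "H = (W, D)" by (cases H)
  ultimately have H: "(W, D) \<in> conn_subgraphs ({..<m + 4}, E)" by (simp add: G)
  have sub: "W \<subseteq> {..<m + 4}" "D \<subseteq> E" "D \<subseteq> Pow W" "W \<noteq> {}"
    using H by (auto simp: conn_subgraphs_def subgraph_def connected_graph_def)
  have parts: "z < m \<or> z \<in> {m, m + 1} \<or> z \<in> {m + 2, m + 3}" if "z \<in> W" for z
  proof -
    have "z < m + 4" using that sub(1) by blast
    then show ?thesis by auto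
  qed
  show "H \<in> ?cover"
  proof (cases "W \<inter> {..<m} = {}")
    case True
    then have out: "0 \<notin> W" "m - 1 \<notin> W" using m by auto
    show ?thesis
    proof (cases "W \<subseteq> {m, m + 1}")
      case True
      then have "H \<in> {({m}, {}), ({m + 1}, {}), ({m, m + 1}, {{m, m + 1}})}"
        unfolding WD by (rule L.off_apex[OF H])
      then show ?thesis by (simp only: Un_iff simp_thms)
    next
      case F: False
      then obtain z where z: "z \<in> W" "z \<notin> {m, m + 1}" by blast
      have "W \<inter> {m, m + 1} = {}" using L.apex_in[OF H _ _ z] out(1) by blast
      then have "W \<subseteq> {m + 2, m + 3}" using parts True by blast
      then have "H \<in> {({m + 2}, {}), ({m + 3}, {}), ({m + 2, m + 3}, {{m + 2, m + 3}})}"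
        unfolding WD by (rule R.off_apex[OF H])
      then show ?thesis by (simp only: Un_iff simp_thms)
    qed
  next
    case False
    define I where "I = W \<inter> {..<m}"
    have fI: "finite I" "I \<noteq> {}" using False by (auto simp: I_def)
    define i where "i = Min I"
    define j where "j = Max I"
    have i: "i \<in> W" "i < m" using Min_in[OF fI] by (auto simp: I_def i_def)
    have j: "j \<in> W" "j < m" using Max_in[OF fI] by (auto simp: I_def j_def)
    have bounds: "i \<le> t \<and> t \<le> j" if "t \<in> W" "t < m" for t
      using that fI by (simp add: i_def j_def I_def)
    have path: "{t, Suc t} \<in> D" if t: "i \<le> t" "t < j" for t
    proof -
      \<comment> \<open>Adding the left triangle to the initial segment leaves the edge from
        \<open>t\<close> to \<open>Suc t\<close> as the only edge that can cross: \<open>0\<close>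
        is inside and \<open>m - 1\<close> is outside.\<close>
      let ?S = "{..t} \<union> {m, m + 1}"
      have S: "i \<in> ?S" "j \<notin> ?S" using t j by auto
      obtain u w where uw: "{u, w} \<in> D" "{u, w} \<in> snd ({..<m + 4}, E)" "u \<in> ?S" "w \<notin> ?S"
        by (rule conn_subgraphs_cut[OF H i(1) j(1) S])
      have "{u, w} \<notin> LE" using uw(3,4) by (auto simp: LE_def doubleton_eq_iff)
      moreover have "{u, w} \<notin> RE" using uw(3,4) t j by (auto simp: RE_def doubleton_eq_iff)
      ultimately have "{u, w} \<in> PE" using uw(2) by (simp add: E_def)
      then obtain s where s: "Suc s < m" "{u, w} = {s, Suc s}" by (auto simp: PE_def)
      then have "s = t" using uw(3,4) by (auto simp: doubleton_eq_iff)
      then show ?thesis using uw(1) s(2) by simp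
    qed
    have I: "W \<inter> {..<m} = {i..j}"
    proof (intro set_eqI iffI)
      fix t assume "t \<in> W \<inter> {..<m}"
      then show "t \<in> {i..j}" using bounds by auto
    next
      fix t assume t: "t \<in> {i..j}"
      show "t \<in> W \<inter> {..<m}"
      proof (cases "t = j")
        case False
        then have "{t, Suc t} \<in> D" using path[of t] t by auto
        then show ?thesis using sub(3) t j by auto
      qed (use j in simp)
    qed
    have P: "D \<inter> PE = {{t, Suc t} |t. i \<le> t \<and> t < j}"
    proof (intro set_eqI iffI)
      fix d assume d: "d \<in> D \<inter> PE"
      then obtain t where t: "Suc t < m" "d = {t, Suc t}" by (auto simp: PE_def)
      then have "t \<in> W" "Suc t \<in> W" using d sub(3) by auto
      then have "i \<le> t" "Suc t \<le> j" using bounds t by auto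
      then show "d \<in> {{t, Suc t} |t. i \<le> t \<and> t < j}" using t by auto
    next
      fix d assume "d \<in> {{t, Suc t} |t. i \<le> t \<and> t < j}"
      then obtain t where t: "i \<le> t" "t < j" "d = {t, Suc t}" by blast
      then have "d \<in> PE" using j by (auto simp: PE_def)
      then show "d \<in> D \<inter> PE" using path t by simp
    qed
    define X where "X = D \<inter> LE"
    define Y where "Y = D \<inter> RE"
    have X: "W \<inter> {m, m + 1} \<subseteq> \<Union>X \<and> \<Union>X \<subseteq> W \<and> (if i = 0 then X \<in> QL else X = {})"
    proof (cases "0 \<in> W")
      case True
      then have "i = 0" using bounds[of 0] m by simp
      then show ?thesis using L.at_apex[OF H True] by (simp add: X_def LE_def QL_def)
    next
      case False
      then have "i \<noteq> 0" using i by metis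
      have "i \<notin> {m, m + 1}" using i by auto
      then have none: "W \<inter> {m, m + 1} = {}" using L.apex_in[OF H _ _ i(1)] False by blast
      then have "X = {}" using sub(3) by (auto simp: X_def LE_def)
      then show ?thesis using none \<open>i \<noteq> 0\<close> by simp
    qed
    have Y: "W \<inter> {m + 2, m + 3} \<subseteq> \<Union>Y \<and> \<Union>Y \<subseteq> W \<and> (if j = m - 1 then Y \<in> QR else Y = {})"
    proof (cases "m - 1 \<in> W")
      case True
      then have "j = m - 1" using bounds[of "m - 1"] m j by linarith
      then show ?thesis using R.at_apex[OF H True] by (simp add: Y_def RE_def QR_def)
    next
      case False
      then have "j \<noteq> m - 1" using j by metis
      have "j \<notin> {m + 2, m + 3}" using j by auto
      then have none: "W \<inter> {m + 2, m + 3} = {}" using R.apex_in[OF H _ _ j(1)] False by blast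
      then have "Y = {}" using sub(3) by (auto simp: Y_def RE_def)
      then show ?thesis using none \<open>j \<noteq> m - 1\<close> by simp
    qed
    have "D = D \<inter> PE \<union> X \<union> Y" using sub(2) by (auto simp: E_def X_def Y_def)
    moreover have "W = {i..j} \<union> \<Union>X \<union> \<Union>Y"
    proof
      show "W \<subseteq> {i..j} \<union> \<Union>X \<union> \<Union>Y" using parts X Y I by blast
      show "{i..j} \<union> \<Union>X \<union> \<Union>Y \<subseteq> W" using X Y I by blast
    qed
    ultimately have H': "H = triangle_path i j X Y" unfolding WD triangle_path_def P by simp
    have ij: "i \<le> j" using bounds i by blast
    consider "i = 0" "j = m - 1" | "i = 0" "j < m - 1" | "i \<ge> 1" "j = m - 1" | "i \<ge> 1" "j < m - 1"
      using j by linarith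
    then show ?thesis
    proof cases
      case 1
      then have "(X, Y) \<in> QL \<times> QR" using X Y by simp
      then have "H \<in> (\<lambda>(X, Y). triangle_path 0 (m - 1) X Y) ` (QL \<times> QR)"
        using H' 1 by (intro image_eqI[of _ _ "(X, Y)"]) simp_all
      then show ?thesis by (simp only: Un_iff simp_thms)
    next
      case 2
      then have "(j, X) \<in> {..<m - 1} \<times> QL" "Y = {}" using X Y by simp_all
      then have "H \<in> (\<lambda>(j, X). triangle_path 0 j X {}) ` ({..<m - 1} \<times> QL)"
        using H' 2 by (intro image_eqI[of _ _ "(j, X)"]) simp_all
      then show ?thesis by (simp only: Un_iff simp_thms)
    next
      case 3
      then have "(i, Y) \<in> {1..<m} \<times> QR" "X = {}" using X Y i by simp_all
      then have "H \<in> (\<lambda>(i, Y). triangle_path i (m - 1) {} Y) ` ({1..<m} \<times> QR)"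
        using H' 3 by (intro image_eqI[of _ _ "(i, Y)"]) simp_all
      then show ?thesis by (simp only: Un_iff simp_thms)
    next
      case 4
      then have "(j, i) \<in> (SIGMA j:{..<m - 1}. {1..j})" "X = {}" "Y = {}" using X Y ij by simp_all
      then have "H \<in> (\<lambda>(j, i). triangle_path i j {} {}) ` (SIGMA j:{..<m - 1}. {1..j})"
        using H' by (intro image_eqI[of _ _ "(j, i)"]) simp_all
      then show ?thesis by (simp only: Un_iff simp_thms)
    qed
  qed
qed

text \<open>The families have total size at most 3 + 3 + 49 + 14(m - 1) + (m - 1)(m - 2)/2, which is
  (n^2 + 17n)/2 for n = m + 4.\<close>

lemma core_index_two_triangle_le:
  assumes n: "n \<ge> 6"
  shows "2 * core_index (two_triangle_graph n) \<le> n\<^sup>2 + 17 * n"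
proof -
  obtain m where m: "n = m + 4" "m \<ge> 2" using that[of "n - 4"] n by simp
  define QL where "QL = Pow {{0, m}, {0, m + 1}, {m, m + 1}} - {{{m, m + 1}}}"
  define QR where "QR = Pow {{m - 1, m + 2}, {m - 1, m + 3}, {m + 2, m + 3}} - {{{m + 2, m + 3}}}"
  have Q: "card QL = 7" "card QR = 7"
    unfolding QL_def QR_def using m(2) by (intro card_triangle_edge_sets; simp)+
  have fQ: "finite QL" "finite QR" unfolding QL_def QR_def by simp_all
  let ?L = "{({m}, {}), ({m + 1}, {}), ({m, m + 1}, {{m, m + 1}})} :: nat ugraph set"
  let ?R = "{({m + 2}, {}), ({m + 3}, {}), ({m + 2, m + 3}, {{m + 2, m + 3}})} :: nat ugraph set"
  let ?B1 = "(\<lambda>(X, Y). triangle_path 0 (m - 1) X Y) ` (QL \<times> QR)"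
  let ?B2 = "(\<lambda>(j, X). triangle_path 0 j X {}) ` ({..<m - 1} \<times> QL)"
  let ?B3 = "(\<lambda>(i, Y). triangle_path i (m - 1) {} Y) ` ({1..<m} \<times> QR)"
  let ?B4 = "(\<lambda>(j, i). triangle_path i j {} {}) ` (SIGMA j:{..<m - 1}. {1..j})"
  have sub: "conn_subgraphs (two_triangle_graph n) \<subseteq> ?L \<union> ?R \<union> ?B1 \<union> ?B2 \<union> ?B3 \<union> ?B4"
    using two_triangle_conn_subgraphs[OF m(2)] unfolding m(1) QL_def QR_def .
  have "core_index (two_triangle_graph n) \<le> card (?L \<union> ?R \<union> ?B1 \<union> ?B2 \<union> ?B3 \<union> ?B4)"
    unfolding core_index_eq using fQ by (intro card_mono[OF _ sub]) auto
  also have "\<dots> \<le> card ?L + card ?R + card ?B1 + card ?B2 + card ?B3 + card ?B4"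
    by (intro card_Un_le[THEN order_trans] add_mono order_refl)
  finally have F: "core_index (two_triangle_graph n)
    \<le> card ?L + card ?R + card ?B1 + card ?B2 + card ?B3 + card ?B4" .
  have cLR: "card ?L \<le> 3" "card ?R \<le> 3" by (simp_all add: card_insert_if)
  have c1: "card ?B1 \<le> 49"
    using card_image_le[of "QL \<times> QR" "\<lambda>(X, Y). triangle_path 0 (m - 1) X Y"] Q fQ by (simp add: card_cartesian_product)
  have c2: "card ?B2 \<le> 7 * (m - 1)"
    using card_image_le[of "{..<m - 1} \<times> QL" "\<lambda>(j, X). triangle_path 0 j X {}"] Q fQ by (simp add: card_cartesian_product)
  have c3: "card ?B3 \<le> 7 * (m - 1)"
    using card_image_le[of "{1..<m} \<times> QR" "\<lambda>(i, Y). triangle_path i (m - 1) {} Y"] Q fQ by (simp add: card_cartesian_product)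
  \<comment> \<open>These are the nonempty intervals of the m - 2 path vertices that are not an
    apex.\<close>
  have c4: "2 * card ?B4 \<le> (m - 1) * (m - 2)"
  proof -
    have "card ?B4 \<le> card (SIGMA j:{..<m - 1}. {1..j})" by (rule card_image_le) simp
    also have "\<dots> = \<Sum>{..<m - 1}" by (subst card_SigmaI) simp_all
    finally have "2 * card ?B4 \<le> 2 * \<Sum>{..<m - 1}" by simp
    also have "2 * \<Sum>{..<k} = k * (k - 1)" for k :: nat
      by (induction k) (auto simp: algebra_simps diff_mult_distrib2)
    finally show ?thesis by (simp add: numeral_2_eq_2)
  qed
  have "2 * core_index (two_triangle_graph n)
    \<le> 2 * (card ?L + card ?R + card ?B1 + card ?B2 + card ?B3) + 2 * card ?B4" using F by simp
  also have "\<dots> \<le> 2 * (3 + 3 + 49 + 7 * (m - 1) + 7 * (m - 1)) + (m - 1) * (m - 2)"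
    by (intro add_mono mult_le_mono order_refl cLR c1 c2 c3 c4)
  also have "\<dots> = n\<^sup>2 + 17 * n"
  proof -
    obtain k where "m = k + 2" using m(2) by (metis add.commute le_Suc_ex)
    then show ?thesis using m(1) by (simp add: power2_eq_square algebra_simps)
  qed
  finally show ?thesis .
qed

theorem theorem5p16:
  fixes G :: "'a ugraph" and n :: nat
  assumes "n \<ge> 5"
    and "simple_graph G"
    and "connected_graph G"
    and "card (fst G) = n"
    and "\<forall>v. \<not> pendant_vertex G v"
  shows "(n \<le> 16 \<longrightarrow> core_index G \<ge> core_index (cycle_graph n))
    \<and> (n > 16 \<longrightarrow> core_index G \<ge> core_index (two_triangle_graph n))
    \<and> real (core_index G) \<ge> min ((real n)\<^sup>2 + 1) (((real n)\<^sup>2 + 17 * real n) / 2)"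
proof -
  obtain V E where VE: "G = (V, E)" by (cases G)
  have G: "connected_graph (V, E)" "simple_graph (V, E)" and V: "card V = n" using assms VE by auto
  have deg: "degree (V, E) x \<ge> 2" if x: "x \<in> V" for x
  proof -
    have "degree (V, E) x \<noteq> 0" using V assms(1) by (intro degree_nonzero[OF G x]) simp
    moreover have "degree (V, E) x \<noteq> 1" using assms(5) x VE by (auto simp: pendant_vertex_def)
    ultimately show ?thesis by linarith
  qed
  have "(\<Sum>x\<in>V. 2) \<le> (\<Sum>x\<in>V. degree (V, E) x)" by (intro sum_mono deg)
  then have "n \<le> card E" using handshake[OF G(2)] V by simp
  then consider "card E = n" | "n < card E" by linarith
  then have alt: "n\<^sup>2 + 1 \<le> core_index G \<or> n\<^sup>2 + 17 * n \<le> 2 * core_index G + (if n = 5 then 2 else 0)"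
  proof cases
    case 1
    then show ?thesis using core_index_two_regular[OF G _ _ deg] V assms(1) VE by simp
  next
    case 2
    then show ?thesis using core_index_bicyclic[OF G] V assms(1) VE by simp
  qed
  show ?thesis
  proof (cases "n \<le> 16")
    case True
    \<comment> \<open>Up to 16 the second alternative implies the first, as then 2(n^2 + 1) is at
      most n^2 + 17n; for n = 5 it still gives 54, far above 26.\<close>
    have "n\<^sup>2 \<le> 16 * n" unfolding power2_eq_square using True by (rule mult_le_mono1)
    then have "n\<^sup>2 + 1 \<le> core_index G"
      using alt assms(1) by (auto split: if_splits)
    moreover from this have "(real n)\<^sup>2 + 1 \<le> real (core_index G)"
      by (metis of_nat_1 of_nat_add of_nat_le_iff of_nat_power)
    ultimately show ?thesis using core_index_cycle_le[of n] assms(1) True by auto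
  next
    case False
    \<comment> \<open>From 17 on the order is reversed: n^2 + 1 exceeds (n^2 + 17n)/2, so the first
      alternative implies the second.\<close>
    have "17 * n \<le> n\<^sup>2" unfolding power2_eq_square using False by (intro mult_le_mono1) simp
    then have F: "n\<^sup>2 + 17 * n \<le> 2 * core_index G"
      using alt False by auto
    then have "real (n\<^sup>2 + 17 * n) \<le> real (2 * core_index G)" by (rule of_nat_mono)
    then have "min ((real n)\<^sup>2 + 1) (((real n)\<^sup>2 + 17 * real n) / 2) \<le> real (core_index G)"
      by (intro min.coboundedI2) simp
    moreover have "2 * core_index (two_triangle_graph n) \<le> n\<^sup>2 + 17 * n"
      using False by (intro core_index_two_triangle_le) simp
    ultimately show ?thesis using F False by simp
  qed
qed

end
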